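(* Consider the Gaussian white noise model with true function $f_0\in L^2[0,1]$, a prior $\Pi=\Pi_n$ on $L^2[0,1]$, and $\alpha_n\in(0,1]$ with $n\alpha_n\to\infty$. Let $\psi:L^2[0,1]\to\mathbb R$ be a functional satisfying, for some $\psi_0\in L^2[0,1]$, $$\psi(f)-\psi(f_0)=\langle\psi_0,f-f_0\rangle_2+r(f,f_0).$$ Suppose that there are measurable sets $A_n\subset L^2[0,1]$ with $\Pi_{\alpha_n}(A_n\mid Y^n)=1+o_P(1)$ and, for every fixed $t\in\mathbb R$, $\sup_{f\in A_n}|t\sqrt{n\alpha_n}\,r(f,f_0)|=o_P(1)$, and that for every $t\in\mathbb R$, with $f_t=f-\frac{t\psi_0}{\sqrt{n\alpha_n}}$, $$\frac{\int_{A_n}e^{\alpha_n\ell_n(f_t)}\,d\Pi(f)}{\int e^{\alpha_n\ell_n(f)}\,d\Pi(f)}=1+o_P(1).$$ Then for $\hat\psi=\psi(f_0)+\frac{1}{\sqrt n}\sum_{k=1}^\infty\psi_{0,k}\varepsilon_k$, where $\psi_{0,k}=\int_0^1\psi_0(t)\phi_k(t)\,dt$, the $\alpha_n$-posterior distribution of $\sqrt{n\alpha_n}(\psi(f)-\hat\psi)$ converges weakly in $P_0$-probability to a Gaussian distribution with mean $0$ and variance $\|\psi_0\|_2^2$.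
   Context: Gaussian white noise model: for $f\in L^2[0,1]$ and an orthonormal basis $(\phi_k)_{k\ge1}$ of $L^2[0,1]$, one observes $Y^n=(Y_k^n)_{k\ge1}$ with $Y^n_k=f_k+\frac1{\sqrt n}\varepsilon_k$, $f_k=\langle f,\phi_k\rangle_2$, $\varepsilon_k$ i.i.d. $\mathcal N(0,1)$. The log-likelihood (up to an additive term not depending on $f$) is $\ell_n(f)=n\sum_kf_kY_k^n-\frac n2\|f\|_2^2$. $P_0$ is the law of the data under $f_0$ (so in $\hat\psi$ the $\varepsilon_k$ are the noise variables under $f_0$); $o_P(1)$ is in $P_0$-probability. The $\alpha_n$-posterior is $\Pi_{\alpha_n}(B\mid Y^n)=\int_Be^{\alpha_n\ell_n}d\Pi/\int e^{\alpha_n\ell_n}d\Pi$. A data-dependent law $Q_Y$ on $\mathbb R$ converges weakly in $P_0$-probability to $\mathcal N(0,V)$ if $d_{BL}(Q_Y,\mathcal N(0,V))\to0$ in $P_0$-probability, with $d_{BL}$ the bounded Lipschitz distance; the $\alpha_n$-posterior distribution of a function of $f$ is the push-forward of $\Pi_{\alpha_n}(\cdot\mid Y^n)$ by that function. *)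

theory Defs
  imports "HOL-Probability.Probability"
begin

section \<open>The Hilbert space $L^2[0,1]$\<close>

definition square_integrable :: "(real \<Rightarrow> real) \<Rightarrow> bool" where
  "square_integrable f \<longleftrightarrow>
     f \<in> borel_measurable (lebesgue_on {0..1}) \<and> integrable (lebesgue_on {0..1}) (\<lambda>x. (f x)\<^sup>2)"

definition L2_rel :: "(real \<Rightarrow> real) \<Rightarrow> (real \<Rightarrow> real) \<Rightarrow> bool" where
  "L2_rel f g \<longleftrightarrow> square_integrable f \<and> square_integrable g \<and> (AE x in lebesgue_on {0..1}. f x = g x)"

lemma square_integrable_zero: "square_integrable (\<lambda>_. 0)"
  by (simp add: square_integrable_def)

lemma square_integrable_mult:
  assumes "square_integrable f" "square_integrable g"
  shows "integrable (lebesgue_on {0..1}) (\<lambda>x. f x * g x)"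
proof (rule Bochner_Integration.integrable_bound)
  show "integrable (lebesgue_on {0..1}) (\<lambda>x. (f x)\<^sup>2 + (g x)\<^sup>2)"
    using assms by (auto simp: square_integrable_def)
  show "(\<lambda>x. f x * g x) \<in> borel_measurable (lebesgue_on {0..1})"
    using assms by (auto simp: square_integrable_def)
  have "\<bar>f x * g x\<bar> \<le> (f x)\<^sup>2 + (g x)\<^sup>2" for x
  proof -
    have "2 * (\<bar>f x\<bar> * \<bar>g x\<bar>) \<le> (f x)\<^sup>2 + (g x)\<^sup>2"
      using sum_squares_bound[of "\<bar>f x\<bar>" "\<bar>g x\<bar>"] by (simp add: mult.assoc)
    moreover have "0 \<le> \<bar>f x\<bar> * \<bar>g x\<bar>"
      by simp
    ultimately show ?thesis
      unfolding abs_mult by linarith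
  qed
  then show "AE x in lebesgue_on {0..1}. norm (f x * g x) \<le> norm ((f x)\<^sup>2 + (g x)\<^sup>2)"
    by auto
qed

lemma square_integrable_scale:
  "square_integrable f \<Longrightarrow> square_integrable (\<lambda>x. c * f x)"
  by (auto simp: square_integrable_def power_mult_distrib)

lemma square_integrable_add:
  assumes "square_integrable f" "square_integrable g"
  shows "square_integrable (\<lambda>x. f x + g x)"
  using assms square_integrable_mult[OF assms]
  by (auto simp: square_integrable_def power2_sum mult.assoc)

quotient_type L2 = "real \<Rightarrow> real" / partial: L2_rel
proof (rule part_equivpI)
  show "\<exists>f. L2_rel f f"
    using square_integrable_zero by (auto simp: L2_rel_def)
  show "symp L2_rel"
    by (auto simp: symp_def L2_rel_def)
  show "transp L2_rel"
    unfolding transp_def L2_rel_def by (auto elim: AE_mp)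
qed

instantiation L2 :: real_inner
begin

lift_definition zero_L2 :: L2 is "\<lambda>_. 0"
  by (simp add: L2_rel_def square_integrable_zero)

lift_definition plus_L2 :: "L2 \<Rightarrow> L2 \<Rightarrow> L2" is "\<lambda>f g x. f x + g x"
  unfolding L2_rel_def by (auto intro: square_integrable_add)

lift_definition scaleR_L2 :: "real \<Rightarrow> L2 \<Rightarrow> L2" is "\<lambda>c f x. c * f x"
  unfolding L2_rel_def by (auto intro: square_integrable_scale)

lift_definition inner_L2 :: "L2 \<Rightarrow> L2 \<Rightarrow> real" is "\<lambda>f g. LINT x|lebesgue_on {0..1}. f x * g x"
  unfolding L2_rel_def square_integrable_def by (auto intro!: integral_cong_AE)

definition uminus_L2 :: "L2 \<Rightarrow> L2" where
  "- f = (-1) *\<^sub>R f" for f :: L2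

definition minus_L2 :: "L2 \<Rightarrow> L2 \<Rightarrow> L2" where
  "f - g = f + (- g)" for f g :: L2

definition norm_L2 :: "L2 \<Rightarrow> real" where
  "norm f = sqrt (inner f f)" for f :: L2

definition sgn_L2 :: "L2 \<Rightarrow> L2" where
  "sgn f = inverse (norm f) *\<^sub>R f" for f :: L2

definition dist_L2 :: "L2 \<Rightarrow> L2 \<Rightarrow> real" where
  "dist f g = norm (f - g)" for f g :: L2

definition uniformity_L2 :: "(L2 \<times> L2) filter" where
  "uniformity_L2 = (INF e\<in>{0<..}. principal {(x, y). dist x y < e})"

definition open_L2 :: "L2 set \<Rightarrow> bool" where
  "open_L2 U = (\<forall>x\<in>U. eventually (\<lambda>(x', y). x' = x \<longrightarrow> y \<in> U) uniformity)"

instance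
proof
  fix f g h :: L2 and a b :: real
  show "f + g + h = f + (g + h)"
    by transfer (auto simp: L2_rel_def add.assoc intro!: square_integrable_add)
  show "f + g = g + f"
    by transfer (auto simp: L2_rel_def add.commute intro!: square_integrable_add)
  show z: "0 + f = f" for f :: L2
    by transfer (auto simp: L2_rel_def)
  show "- f + f = 0"
    unfolding uminus_L2_def
    by transfer (auto simp: L2_rel_def square_integrable_zero)
  show "f - g = f + - g"
    by (simp add: minus_L2_def)
  show "a *\<^sub>R (f + g) = a *\<^sub>R f + a *\<^sub>R g"
    by transfer (auto simp: L2_rel_def algebra_simps intro!: square_integrable_add square_integrable_scale)
  show "(a + b) *\<^sub>R f = a *\<^sub>R f + b *\<^sub>R f"
    by transfer
      (auto simp: L2_rel_def ring_distribs intro!: square_integrable_add square_integrable_scale)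
  show "a *\<^sub>R b *\<^sub>R f = (a * b) *\<^sub>R f"
    by transfer (auto simp: L2_rel_def mult.assoc[symmetric] intro!: square_integrable_scale)
  show "1 *\<^sub>R f = f"
    by transfer (auto simp: L2_rel_def)
  show "sgn f = inverse (norm f) *\<^sub>R f"
    by (simp add: sgn_L2_def)
  show "dist f g = norm (f - g)"
    by (simp add: dist_L2_def)
  show "(uniformity :: (L2 \<times> L2) filter) = (INF e\<in>{0<..}. principal {(x, y). dist x y < e})"
    by (simp add: uniformity_L2_def)
  show "open U = (\<forall>x\<in>U. \<forall>\<^sub>F (x', y) in uniformity. x' = x \<longrightarrow> y \<in> U)" for U :: "L2 set"
    by (simp add: open_L2_def)
  show "inner f g = inner g f"
    by transfer (simp add: mult.commute)
  show "inner (f + g) h = inner f h + inner g h"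
    by transfer (simp add: L2_rel_def ring_distribs square_integrable_mult)
  show "inner (a *\<^sub>R f) g = a * inner f g"
    by transfer (simp add: mult.assoc)
  show "0 \<le> inner f f"
    by transfer simp
  show "(inner f f = 0) = (f = 0)"
  proof transfer
    fix f assume "L2_rel f f"
    then have f: "square_integrable f" by (simp add: L2_rel_def)
    have "(LINT x|lebesgue_on {0..1}. f x * f x) = 0 \<longleftrightarrow> (AE x in lebesgue_on {0..1}. f x * f x = 0)"
      by (rule integral_nonneg_eq_0_iff_AE) (use square_integrable_mult[OF f f] in auto)
    then show "((LINT x|lebesgue_on {0..1}. f x * f x) = 0) = L2_rel f (\<lambda>_. 0)"
      using f square_integrable_zero by (simp add: L2_rel_def)
  qed
  show "norm f = sqrt (inner f f)"
    by (simp add: norm_L2_def)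
qed

end

definition orthonormal_basis :: "(nat \<Rightarrow> L2) \<Rightarrow> bool" where
  "orthonormal_basis \<phi> \<longleftrightarrow>
     (\<forall>j k. inner (\<phi> j) (\<phi> k) = (if j = k then 1 else 0)) \<and> closure (span (range \<phi>)) = UNIV"


section \<open>Convergence in probability and weak convergence in probability\<close>

text \<open>
  The events are measured by the outer measure, which agrees with the measure on measurable
  events and does not assign mass zero to a non-measurable one by convention.
  Extended real values allow for suprema that are infinite for some indices.
\<close>

definition small_o_P :: "'w measure \<Rightarrow> (nat \<Rightarrow> 'w \<Rightarrow> ereal) \<Rightarrow> bool" where
  "small_o_P M X \<longleftrightarrow>
     (\<forall>\<epsilon>::real. \<epsilon> > 0 \<longrightarrow>
        (\<lambda>n. outer_measure_of M {\<omega> \<in> space M. \<bar>X n \<omega>\<bar> > ereal \<epsilon>}) \<longlonglongrightarrow> 0)"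

text \<open>$\mathcal N(m, V)$, where $\mathcal N(m, 0)$ is the point mass at $m$.\<close>

definition gaussian :: "real \<Rightarrow> real \<Rightarrow> real measure" where
  "gaussian m V =
     (if V = 0 then return borel m else density lborel (\<lambda>x. ennreal (normal_density m (sqrt V) x)))"

definition bounded_lipschitz_dist :: "real measure \<Rightarrow> real measure \<Rightarrow> ereal" where
  "bounded_lipschitz_dist \<mu> \<nu> =
     (SUP h \<in> {h :: real \<Rightarrow> real. (\<forall>x. \<bar>h x\<bar> \<le> 1) \<and> 1-lipschitz_on UNIV h}.
        ereal \<bar>(LINT x|\<mu>. h x) - (LINT x|\<nu>. h x)\<bar>)"

definition weakly_in_prob :: "'w measure \<Rightarrow> (nat \<Rightarrow> 'w \<Rightarrow> real measure) \<Rightarrow> real measure \<Rightarrow> bool" where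
  "weakly_in_prob M Q \<nu> \<longleftrightarrow> small_o_P M (\<lambda>n \<omega>. bounded_lipschitz_dist (Q n \<omega>) \<nu>)"


section \<open>Gaussian white noise model and tempered posteriors\<close>

text \<open>The basis, the noise and the data are indexed by $k \geq 0$ instead of $k \geq 1$.\<close>

definition iid_std_normal :: "'w measure \<Rightarrow> (nat \<Rightarrow> 'w \<Rightarrow> real) \<Rightarrow> bool" where
  "iid_std_normal M \<epsilon> \<longleftrightarrow>
     prob_space.indep_vars M (\<lambda>_. borel) \<epsilon> UNIV \<and>
     (\<forall>k. distributed M lborel (\<epsilon> k) (\<lambda>x. ennreal (std_normal_density x)))"

definition white_noise_obs :: "(nat \<Rightarrow> L2) \<Rightarrow> L2 \<Rightarrow> (nat \<Rightarrow> real) \<Rightarrow> nat \<Rightarrow> nat \<Rightarrow> real" where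
  "white_noise_obs \<phi> f e n k = inner f (\<phi> k) + 1 / sqrt (real n) * e k"

definition loglik :: "(nat \<Rightarrow> L2) \<Rightarrow> nat \<Rightarrow> (nat \<Rightarrow> real) \<Rightarrow> L2 \<Rightarrow> real" where
  "loglik \<phi> n y f = real n * (\<Sum>k. inner f (\<phi> k) * y k) - real n / 2 * (norm f)\<^sup>2"

definition alpha_posterior ::
    "(nat \<Rightarrow> L2) \<Rightarrow> nat \<Rightarrow> L2 measure \<Rightarrow> real \<Rightarrow> (nat \<Rightarrow> real) \<Rightarrow> L2 measure" where
  "alpha_posterior \<phi> n prior \<alpha> y =
     density prior (\<lambda>f. ennreal (exp (\<alpha> * loglik \<phi> n y f) / (LINT g|prior. exp (\<alpha> * loglik \<phi> n y g))))"

end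

theory Submission
  imports Defs "HOL-Complex_Analysis.Complex_Analysis"
begin

text \<open>
  Write $W$ for the limit of the noise series of $\psi_0$ and
  $Z(f) = \sqrt{n\alpha_n}\,(\langle \psi_0, f - f_0\rangle - W/\sqrt n)$. Expanding the Gaussian
  log-likelihood gives
  $\alpha_n \ell_n(f_t) = \alpha_n \ell_n(f) + t Z(f) - t^2 \|\psi_0\|^2/2$, so the assumption on the
  ratio of integrals says that the Laplace transform of $Z$ under the posterior restricted to $A_n$
  converges in probability to the one of $\mathcal N(0, \|\psi_0\|^2)$ at every real $t$. Pointwise
  convergence of Laplace transforms forces weak convergence, and on $A_n$ the variable
  $\sqrt{n\alpha_n}(\psi(f) - \hat\psi)$ differs from $Z$ only by the negligible remainder.
\<close>

section \<open>Laplace transforms and weak convergence\<close>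

text \<open>The hypotheses hold in probability for each \<open>t\<close> separately, whereas the
  bounded Lipschitz distance is a supremum over uncountably many test functions, whose measurability
  in the noise is not established. The probabilistic part is therefore confined to finitely many
  events, measured by outer measure, and the rest is a deterministic statement at a fixed
  \<open>n\<close> and a fixed noise. Exponential integrability under the posterior is not given
  either. It is extracted from the convention that a non-integrable function has integral zero: an
  integral close enough to a nonzero number must come from an integrable function. Finally, the
  posterior restricted to \<open>A n\<close> is in general not a probability measure. Instead of
  renormalising it, the proof takes the law of \<open>indicator A f * Z f\<close>, which moves the
  mass outside the set to the point zero and adds exactly that mass to the Laplace
  transform.\<close>

definition mgf :: "real measure \<Rightarrow> complex \<Rightarrow> complex" where
  "mgf M z = (LINT x|M. exp (z * of_real x))"

lemma (in real_distribution) integrable_exp_abs: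
  assumes "\<And>t::real. integrable M (\<lambda>x. exp (t * x))"
  shows "integrable M (\<lambda>x. exp (t * \<bar>x\<bar>))"
proof (rule Bochner_Integration.integrable_bound)
  show "integrable M (\<lambda>x. exp (t * x) + exp (- t * x))"
    using assms by (intro Bochner_Integration.integrable_add)
  show "AE x in M. norm (exp (t * \<bar>x\<bar>)) \<le> norm (exp (t * x) + exp (- t * x))"
  proof (intro AE_I2)
    fix x
    show "norm (exp (t * \<bar>x\<bar>)) \<le> norm (exp (t * x) + exp (- t * x))"
      using add_pos_pos[OF exp_gt_zero[of "t * x"] exp_gt_zero[of "- (t * x)"]]
      by (cases "x < 0") auto
  qed
qed measurable

text \<open>Dominated convergence exchanges the integral with the exponential series, every partial
  sum being bounded by \<open>exp (norm z * \<bar>x\<bar>)\<close>. This gives a power series in the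
  moments that converges at every \<open>z\<close>, so the transform is entire.\<close>

lemma (in real_distribution) mgf_holomorphic:
  assumes mgf: "\<And>t::real. integrable M (\<lambda>x. exp (t * x))"
  shows "mgf M holomorphic_on UNIV"
proof -
  define a :: "nat \<Rightarrow> complex" where "a k = of_real ((LINT x|M. x ^ k) / fact k)" for k
  have abs_pow: "integrable M (\<lambda>x. x ^ k)" for k
  proof (rule Bochner_Integration.integrable_bound[OF integrable_mult_right[OF integrable_exp_abs[OF mgf, of 1]]])
    have "\<bar>x\<bar> ^ k \<le> fact k * exp \<bar>x\<bar>" for x :: real
    proof -
      have "(\<Sum>i\<in>{k}. \<bar>x\<bar> ^ i /\<^sub>R fact i) \<le> exp \<bar>x\<bar>"
        unfolding exp_def by (intro sum_le_suminf summable_exp_generic) auto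
      then show ?thesis by (simp add: field_simps)
    qed
    then show "AE x in M. norm (x ^ k) \<le> norm (fact k * exp (1 * \<bar>x\<bar>))"
      by (intro AE_I2) (simp add: power_abs)
  qed measurable
  have "(\<lambda>k. a k * z ^ k) sums mgf M z" for z
  proof -
    let ?s = "\<lambda>N x. (\<Sum>k<N. (z * of_real x) ^ k /\<^sub>R fact k) :: complex"
    have "(\<lambda>N. LINT x|M. ?s N x) \<longlonglongrightarrow> (LINT x|M. exp (z * of_real x))"
    proof (rule integral_dominated_convergence)
      show "integrable M (\<lambda>x. exp (norm z * \<bar>x\<bar>))"
        by (rule integrable_exp_abs[OF mgf])
      show "AE x in M. (\<lambda>N. ?s N x) \<longlonglongrightarrow> exp (z * of_real x)"
        by (intro AE_I2) (use exp_converges in \<open>auto simp: sums_def\<close>)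
      show "AE x in M. norm (?s N x) \<le> exp (norm z * \<bar>x\<bar>)" for N
      proof (rule AE_I2)
        fix x :: real
        have "norm (?s N x) \<le> (\<Sum>k<N. (norm z * \<bar>x\<bar>) ^ k /\<^sub>R fact k)"
          by (rule order_trans[OF norm_sum]) (simp add: norm_power norm_mult)
        also have "\<dots> \<le> exp (norm z * \<bar>x\<bar>)"
          unfolding exp_def by (intro sum_le_suminf summable_exp_generic) auto
        finally show "norm (?s N x) \<le> exp (norm z * \<bar>x\<bar>)" .
      qed
    qed measurable
    also have "(\<lambda>N. LINT x|M. ?s N x) = (\<lambda>N. \<Sum>k<N. a k * z ^ k)"
    proof (rule ext)
      fix N
      have "(LINT x|M. ?s N x) = (LINT x|M. (\<Sum>k<N. (z ^ k / fact k) * complex_of_real (x ^ k)))"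
        by (simp add: power_mult_distrib scaleR_conv_of_real divide_simps)
      also have "\<dots> = (\<Sum>k<N. (z ^ k / fact k) * complex_of_real (LINT x|M. x ^ k))"
        by (subst Bochner_Integration.integral_sum)
           (use abs_pow in \<open>auto simp del: of_real_power simp: integral_complex_of_real\<close>)
      finally show "(LINT x|M. ?s N x) = (\<Sum>k<N. a k * z ^ k)"
        by (simp add: a_def field_simps)
    qed
    finally show ?thesis by (simp add: sums_def mgf_def)
  qed
  then have "mgf M holomorphic_on ball 0 r" for r
    by (intro power_series_holomorphic[where a=a]) auto
  then show ?thesis
    by (metis at_within_open centre_in_ball dist_0_norm field_differentiable_at_within
        gt_ex holomorphic_onI holomorphic_on_imp_differentiable_at mem_ball open_ball UNIV_I)
qed

lemma mgf_of_real: "mgf M (of_real t) = of_real (LINT x|M. exp (t * x))"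
proof -
  have "exp (of_real t * of_real x) = complex_of_real (exp (t * x))" for x
    by (simp flip: exp_of_real)
  then show ?thesis
    by (simp add: mgf_def integral_complex_of_real del: of_real_exp)
qed

text \<open>Both transforms are entire and the rationals accumulate at \<open>0\<close>, so the
  identity theorem makes them equal on the whole plane; on the imaginary axis they are the
  characteristic functions. Agreement at rational \<open>t\<close> only keeps the arguments
  countable, as the enumeration in \<open>mgf_close_imp_lipschitz_close\<close> requires.\<close>

theorem mgf_uniqueness:
  assumes "real_distribution M" "real_distribution N"
    and "\<And>t::real. integrable M (\<lambda>x. exp (t * x))" "\<And>t::real. integrable N (\<lambda>x. exp (t * x))"
    and eq: "\<And>t::real. t \<in> \<rat> \<Longrightarrow> (LINT x|M. exp (t * x)) = (LINT x|N. exp (t * x))"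
  shows "M = N"
proof -
  have "(mgf M z - mgf N z) = 0" for z
  proof (rule analytic_continuation[where f="\<lambda>z. mgf M z - mgf N z" and S=UNIV and U="of_real ` \<rat>" and \<xi>=0])
    show "(\<lambda>z. mgf M z - mgf N z) holomorphic_on UNIV"
      by (intro holomorphic_intros real_distribution.mgf_holomorphic assms)
    have "(\<lambda>n. complex_of_real (inverse (of_nat (Suc n)))) \<longlonglongrightarrow> of_real 0"
      by (intro tendsto_of_real LIMSEQ_inverse_real_of_nat)
    then show "(0::complex) islimpt of_real ` \<rat>"
      unfolding islimpt_sequential
      by (intro exI[of _ "\<lambda>n. complex_of_real (inverse (of_nat (Suc n)))"])
         (auto simp del: of_nat_Suc of_real_inverse of_real_of_nat_eq intro!: imageI)
  qed (auto simp: mgf_of_real eq)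
  then have eq: "mgf M z = mgf N z" for z
    by (metis eq_iff_diff_eq_0)
  have "char M = char N"
  proof (rule ext)
    fix t
    show "char M t = char N t"
      using eq[of "\<i> * of_real t"] by (simp add: mgf_def char_def mult.assoc)
  qed
  with assms show ?thesis
    by (intro Levy_uniqueness)
qed

section \<open>The Gaussian limit law and its Laplace transform\<close>

lemma gaussian_real_distribution: "V \<ge> 0 \<Longrightarrow> real_distribution (gaussian m V)"
  unfolding real_distribution_def real_distribution_axioms_def gaussian_def
  by (auto intro!: prob_space_return prob_space_normal_density)

lemma gaussian_exp:
  assumes "V \<ge> 0"
  shows "integrable (gaussian 0 V) (\<lambda>x. exp (t * x))"
    and "(LINT x|gaussian 0 V. exp (t * x)) = exp (t\<^sup>2 * V / 2)"
proof -
  have "integrable (gaussian 0 V) (\<lambda>x. exp (t * x)) \<and> (LINT x|gaussian 0 V. exp (t * x)) = exp (t\<^sup>2 * V / 2)"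
  proof (cases "V = 0")
    \<comment> \<open>The degenerate case occurs for \<open>\<psi>0 = 0\<close>, where the limit is
      the point mass at zero.\<close>
    case True
    then show ?thesis
      by (auto simp: gaussian_def integral_return intro!: integrableI_bounded simp: nn_integral_return)
  next
    case False
    with assms have V: "V > 0" by simp
    \<comment> \<open>Completing the square: tilting the centred density by
      \<open>exp (t * x)\<close> moves the mean to \<open>t * V\<close>.\<close>
    have *: "normal_density 0 (sqrt V) x * exp (t * x)
        = exp (t\<^sup>2 * V / 2) * normal_density (t * V) (sqrt V) x" for x
    proof -
      have "- x\<^sup>2 / (2 * V) + t * x = t\<^sup>2 * V / 2 + (- (x - t * V)\<^sup>2 / (2 * V))"
        using V by (simp add: field_simps power2_eq_square)
      then have "exp (- x\<^sup>2 / (2 * V)) * exp (t * x) = exp (t\<^sup>2 * V / 2) * exp (- (x - t * V)\<^sup>2 / (2 * V))"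
        by (metis exp_add)
      then show ?thesis using V by (simp add: normal_density_def field_simps)
    qed
    have "integrable lborel (\<lambda>x. normal_density 0 (sqrt V) x * exp (t * x))"
      unfolding * using V by (intro integrable_mult_right integrable_normal_density) auto
    moreover have "(LINT x|lborel. normal_density 0 (sqrt V) x * exp (t * x)) = exp (t\<^sup>2 * V / 2)"
      unfolding * using V by (simp add: integral_normal_density)
    ultimately show ?thesis
      using False by (auto simp: gaussian_def integrable_density integral_density)
  qed
  then show "integrable (gaussian 0 V) (\<lambda>x. exp (t * x))"
    and "(LINT x|gaussian 0 V. exp (t * x)) = exp (t\<^sup>2 * V / 2)" by auto
qed

section \<open>Weak convergence from convergence of Laplace transforms\<close>

text \<open>Weak convergence handles bounded functions only, so \<open>exp (t * x)\<close> is
  truncated at \<open>K\<close>. The truncation error is at most \<open>exp (2 * t * x) / K\<close>,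
  so convergence of the transforms at \<open>2 * t\<close> supplies the uniform
  integrability.\<close>

lemma mgf_weak_limit:
  fixes t :: real
  assumes "\<And>n. real_distribution (\<mu> n)" "real_distribution \<nu>" "weak_conv_m \<mu> \<nu>"
    and L1: "(\<lambda>n. LINT x|\<mu> n. exp (t * x)) \<longlonglongrightarrow> L1" and L2: "(\<lambda>n. LINT x|\<mu> n. exp (2 * t * x)) \<longlonglongrightarrow> L2"
    and pos: "L1 \<noteq> 0" "L2 \<noteq> 0"
  shows "integrable \<nu> (\<lambda>x. exp (t * x))" "(LINT x|\<nu>. exp (t * x)) = L1"
proof -
  interpret \<mu>: real_distribution "\<mu> n" for n by fact
  interpret \<nu>: real_distribution \<nu> by fact
  define h :: "real \<Rightarrow> real \<Rightarrow> real" where "h K x = min (exp (t * x)) K" for K x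
  have h_meas [measurable]: "h K \<in> borel_measurable borel" for K
    unfolding h_def by measurable
  have h_cont: "isCont (h K) x" for K x
    unfolding h_def by (intro continuous_intros)
  have h_bd: "norm (h K x) \<le> K" if "K > 0" for K x
    using that by (simp add: h_def)
  \<comment> \<open>A non-integrable exponential would have integral \<open>0\<close>, so a nonzero
    limit forces integrability for all large \<open>n\<close>.\<close>
  have int_nz: "eventually (\<lambda>n. integrable (\<mu> n) (\<lambda>x. exp (c * x))) sequentially"
    if "(\<lambda>n. LINT x|\<mu> n. exp (c * x)) \<longlonglongrightarrow> l" "l \<noteq> 0" for c l
    using tendsto_imp_eventually_ne[OF that]
    by eventually_elim (use not_integrable_integral_eq in blast)
  have bound: "\<bar>L1 - (LINT x|\<nu>. h K x)\<bar> \<le> L2 / K" if K: "K > 0" for K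
  proof (rule tendsto_le[OF sequentially_bot])
    show "(\<lambda>n. (LINT x|\<mu> n. exp (2 * t * x)) / K) \<longlonglongrightarrow> L2 / K"
      by (intro tendsto_intros L2) (use K in simp)
    have "(\<lambda>n. LINT x|\<mu> n. h K x) \<longlonglongrightarrow> (LINT x|\<nu>. h K x)"
      by (rule weak_conv_imp_integral_bdd_continuous_conv[where B=K]) (use assms h_cont h_bd[OF K] in auto)
    then show "(\<lambda>n. \<bar>(LINT x|\<mu> n. exp (t * x)) - (LINT x|\<mu> n. h K x)\<bar>) \<longlonglongrightarrow> \<bar>L1 - (LINT x|\<nu>. h K x)\<bar>"
      by (intro tendsto_intros L1)
    show "eventually (\<lambda>n. \<bar>(LINT x|\<mu> n. exp (t * x)) - (LINT x|\<mu> n. h K x)\<bar> \<le> (LINT x|\<mu> n. exp (2 * t * x)) / K) sequentially"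
      using int_nz[OF L1 pos(1)] int_nz[OF L2 pos(2)]
    proof eventually_elim
      case (elim n)
      have int_h: "integrable (\<mu> n) (h K)"
        by (rule \<mu>.integrable_const_bound[where B=K]) (use h_bd[OF K] in auto)
      have *: "0 \<le> exp (t * x) - h K x \<and> exp (t * x) - h K x \<le> exp (2 * t * x) / K" for x
      proof (cases "exp (t * x) \<le> K")
        case False
        have "exp (t * x) * K \<le> exp (t * x) * exp (t * x)"
          using False by (intro mult_left_mono) auto
        also have "\<dots> = exp (2 * t * x)" by (simp flip: exp_add add: field_simps)
        finally have "exp (t * x) \<le> exp (2 * t * x) / K" using K by (simp add: field_simps)
        then show ?thesis using False K by (simp add: h_def)
      qed (use K in \<open>simp add: h_def\<close>)
      have "(LINT x|\<mu> n. exp (t * x)) - (LINT x|\<mu> n. h K x) = (LINT x|\<mu> n. exp (t * x) - h K x)"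
        using elim int_h by simp
      moreover have "0 \<le> (LINT x|\<mu> n. exp (t * x) - h K x)"
        using * by (intro Bochner_Integration.integral_nonneg) auto
      moreover have "(LINT x|\<mu> n. exp (t * x) - h K x) \<le> (LINT x|\<mu> n. exp (2 * t * x) / K)"
        using * elim int_h by (intro integral_mono) auto
      ultimately show ?case by simp
    qed
  qed
  \<comment> \<open>Along \<open>K = Suc k\<close> the truncations increase to
    \<open>exp (t * x)\<close> and their integrals tend to \<open>L1\<close>; monotone convergence
    then yields integrability and the value of the integral together.\<close>
  have lim: "(\<lambda>k. LINT x|\<nu>. h (real (Suc k)) x) \<longlonglongrightarrow> L1"
  proof (rule LIM_zero_cancel, rule Lim_null_comparison)
    show "eventually (\<lambda>k. norm ((LINT x|\<nu>. h (real (Suc k)) x) - L1) \<le> L2 * (1 / real (Suc k))) sequentially"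
      using bound[of "real (Suc _)"] by (intro always_eventually) (auto simp: abs_minus_commute)
    show "(\<lambda>k. L2 * (1 / real (Suc k))) \<longlonglongrightarrow> 0"
      using tendsto_mult_right_zero[OF LIMSEQ_inverse_real_of_nat] by (simp add: inverse_eq_divide)
  qed
  have int_h: "integrable \<nu> (h (real (Suc k)))" for k
    by (rule \<nu>.integrable_const_bound[where B="real (Suc k)"]) (use h_bd[of "real (Suc k)"] in auto)
  have mono: "AE x in \<nu>. mono (\<lambda>k. h (real (Suc k)) x)"
    by (intro AE_I2) (auto simp: mono_def h_def)
  have ptw: "AE x in \<nu>. (\<lambda>k. h (real (Suc k)) x) \<longlonglongrightarrow> exp (t * x)"
  proof (intro AE_I2 tendsto_eventually)
    fix x
    show "eventually (\<lambda>k. h (real (Suc k)) x = exp (t * x)) sequentially"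
      using eventually_ge_at_top[of "nat \<lceil>exp (t * x)\<rceil>"]
      by eventually_elim (auto simp: h_def nat_le_iff ceiling_le_iff)
  qed
  show "integrable \<nu> (\<lambda>x. exp (t * x))"
    by (rule integrable_monotone_convergence[OF int_h mono ptw lim]) measurable
  show "(LINT x|\<nu>. exp (t * x)) = L1"
    by (rule integral_monotone_convergence[OF int_h mono ptw lim]) measurable
qed

text \<open>Outside \<open>{-K<..K}\<close> the function \<open>exp x + exp (- x)\<close> is at
  least \<open>exp K\<close>, so Markov's inequality bounds the tail by
  \<open>2 * B * exp (- K)\<close> uniformly in \<open>n\<close>.\<close>

lemma mgf_tight:
  assumes "\<And>n. real_distribution (\<mu> n)"
    and int: "\<And>n. integrable (\<mu> n) (\<lambda>x. exp x)" "\<And>n. integrable (\<mu> n) (\<lambda>x. exp (- x))"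
    and bd: "\<And>n. (LINT x|\<mu> n. exp x) \<le> B" "\<And>n. (LINT x|\<mu> n. exp (- x)) \<le> B"
  shows "tight \<mu>"
  unfolding tight_def
proof (intro conjI allI impI)
  interpret \<mu>: real_distribution "\<mu> n" for n by fact
  fix e :: real assume e: "e > 0"
  have "((\<lambda>K::real. 2 * B * exp (- K)) \<longlongrightarrow> 0) at_top" by real_asymp
  then have "eventually (\<lambda>K::real. 2 * B * exp (- K) < e) at_top"
    using e by (intro order_tendstoD(2)) auto
  then obtain K where K: "K > 0" "2 * B * exp (- K) < e"
    using eventually_conj[OF eventually_gt_at_top[of "0::real"]]
    by (metis (mono_tags, lifting) eventually_happens' trivial_limit_at_top_linorder)
  have "measure (\<mu> n) {-K<..K} > 1 - e" for n
  proof -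
    have "\<mu>.prob n {x \<in> space (\<mu> n). exp K \<le> exp x + exp (- x)} \<le> (LINT x|\<mu> n. exp x + exp (- x)) / exp K"
      by (intro integral_Markov_inequality_measure[where A="{}"]) (use int in \<open>auto intro!: add_nonneg_nonneg\<close>)
    also have "\<dots> \<le> 2 * B * exp (- K)"
    proof -
      have "(LINT x|\<mu> n. exp x + exp (- x)) \<le> 2 * B"
        using bd[of n] int[of n] by simp
      then show ?thesis
        by (simp add: exp_minus divide_inverse mult_right_mono)
    qed
    also have "\<dots> < e" by (rule K)
    finally have "\<mu>.prob n {x \<in> space (\<mu> n). exp K \<le> exp x + exp (- x)} < e" .
    moreover have "\<mu>.prob n (space (\<mu> n) - {-K<..K}) \<le> \<mu>.prob n {x \<in> space (\<mu> n). exp K \<le> exp x + exp (- x)}"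
    proof (intro \<mu>.finite_measure_mono)
      have "exp K \<le> exp x + exp (- x)" if "x \<notin> {-K<..K}" for x
      proof -
        have "K \<le> x \<or> K \<le> - x" using that by auto
        then have "exp K \<le> exp x \<or> exp K \<le> exp (- x)" by auto
        then show ?thesis by (smt (verit) exp_gt_zero)
      qed
      then show "space (\<mu> n) - {-K<..K} \<subseteq> {x \<in> space (\<mu> n). exp K \<le> exp x + exp (- x)}" by auto
    qed measurable
    ultimately show ?thesis
      using \<mu>.prob_compl[of "{-K<..K}" n] by simp
  qed
  then show "\<exists>a b. a < b \<and> (\<forall>n. 1 - e < measure (\<mu> n) {a<..b})"
    using K by (intro exI[of _ "-K"] exI[of _ K]) auto
qed (use assms in auto)

text \<open>The arguments \<open>1\<close> and \<open>-1\<close> give tightness, so it remains to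
  identify the weak subsequential limits. Each of them inherits the transform of \<open>N\<close> at
  every rational, which determines it.\<close>

theorem mgf_convergence_imp_weak_conv:
  assumes \<mu>: "\<And>n. real_distribution (\<mu> n)" and N: "real_distribution N"
    and int: "\<And>n. integrable (\<mu> n) (\<lambda>x. exp x)" "\<And>n. integrable (\<mu> n) (\<lambda>x. exp (- x))"
    and intN: "\<And>t::real. integrable N (\<lambda>x. exp (t * x))"
    and conv: "\<And>t::real. t \<in> \<rat> \<Longrightarrow> (\<lambda>n. LINT x|\<mu> n. exp (t * x)) \<longlonglongrightarrow> (LINT x|N. exp (t * x))"
  shows "weak_conv_m \<mu> N"
proof (rule tight_subseq_weak_converge[OF \<mu> N])
  interpret N: real_distribution N by fact
  have "Bseq (\<lambda>n. LINT x|\<mu> n. exp x)" "Bseq (\<lambda>n. LINT x|\<mu> n. exp (- x))"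
    using conv[of 1] conv[of "-1"] by (auto intro!: convergent_imp_Bseq convergentI)
  then obtain B1 B2 where "\<And>n. (LINT x|\<mu> n. exp x) \<le> B1" "\<And>n. (LINT x|\<mu> n. exp (- x)) \<le> B2"
    unfolding Bseq_def by (metis abs_le_D1 real_norm_def)
  then show "tight \<mu>"
    by (intro mgf_tight[where B="max B1 B2"] \<mu> int) (auto simp: le_max_iff_disj)
  fix s \<nu> assume s: "strict_mono s" and \<nu>: "real_distribution \<nu>" and w: "weak_conv_m (\<mu> \<circ> s) \<nu>"
  \<comment> \<open>\<open>mgf_weak_limit\<close> recovers integrability along the subsequence from
    limits that are not zero.\<close>
  have pos: "(LINT x|N. exp (t * x)) \<noteq> 0" for t :: real
    using N.integral_less_AE_space[of "\<lambda>_. 0" "\<lambda>x. exp (t * x)"] intN[of t] N.emeasure_space_1 by simp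
  have rat: "integrable \<nu> (\<lambda>x. exp (t * x)) \<and> (LINT x|\<nu>. exp (t * x)) = (LINT x|N. exp (t * x))"
    if "t \<in> \<rat>" for t
    using mgf_weak_limit[of "\<mu> \<circ> s", OF _ \<nu> w, of t "LINT x|N. exp (t * x)" "LINT x|N. exp (2 * t * x)"]
      LIMSEQ_subseq_LIMSEQ[OF conv s, of t] LIMSEQ_subseq_LIMSEQ[OF conv s, of "2 * t"] pos \<mu> that
    by (auto simp: o_def)
  \<comment> \<open>Uniqueness asks for integrability at every real exponent; a rational exponent
    above \<open>\<bar>t\<bar>\<close> dominates.\<close>
  have "integrable \<nu> (\<lambda>x. exp (t * x))" for t :: real
  proof -
    interpret \<nu>: real_distribution \<nu> by fact
    obtain q :: real where q: "q \<in> \<rat>" "\<bar>t\<bar> < q" using Rats_dense_in_real[of "\<bar>t\<bar>" "\<bar>t\<bar> + 1"] by auto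
    show ?thesis
    proof (rule Bochner_Integration.integrable_bound)
      show "integrable \<nu> (\<lambda>x. exp (q * x) + exp (- q * x))"
        using rat[of q] rat[of "-q"] q by (intro Bochner_Integration.integrable_add) auto
      have "exp (t * x) \<le> exp (q * x) + exp (- q * x)" for x
      proof -
        have "t * x \<le> \<bar>t\<bar> * \<bar>x\<bar>" by (metis abs_ge_self abs_mult)
        also have "\<dots> \<le> q * \<bar>x\<bar>" using q by (intro mult_right_mono) auto
        finally have "exp (t * x) \<le> exp (q * x) \<or> exp (t * x) \<le> exp (- q * x)" by (auto simp: abs_if split: if_splits)
        then show ?thesis by (smt (verit) exp_gt_zero)
      qed
      then show "AE x in \<nu>. norm (exp (t * x)) \<le> norm (exp (q * x) + exp (- q * x))"
        by (intro AE_I2) (smt (verit) exp_gt_zero real_norm_def)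
    qed measurable
  qed
  then have "\<nu> = N" using rat by (intro mgf_uniqueness \<nu> N intN) auto
  then show "weak_conv_m (\<mu> \<circ> s) N" using w by simp
qed

text \<open>The test function changes with \<open>n\<close>, so convergence for one fixed function
  does not suffice. In the Skorohod representation the variables converge pointwise, and the common
  Lipschitz constant bounds the difference of the test values by
  \<open>\<bar>X n x - Z x\<bar>\<close>, whichever \<open>h n\<close> is used.\<close>

lemma weak_conv_uniform_lipschitz:
  fixes h :: "nat \<Rightarrow> real \<Rightarrow> real"
  assumes \<mu>: "\<And>n. real_distribution (\<mu> n)" and N: "real_distribution N" and w: "weak_conv_m \<mu> N"
    and lip: "\<And>n. 1-lipschitz_on UNIV (h n)" and bd: "\<And>n x. \<bar>h n x\<bar> \<le> 1"
  shows "(\<lambda>n. (LINT x|\<mu> n. h n x) - (LINT x|N. h n x)) \<longlonglongrightarrow> 0"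
proof -
  from Skorohod[OF \<mu> N w] obtain \<Omega> :: "real measure" and X Z where
      *: "prob_space \<Omega> \<and> (\<forall>n. X n \<in> measurable \<Omega> borel) \<and> (\<forall>n. distr \<Omega> borel (X n) = \<mu> n) \<and>
       Z \<in> measurable \<Omega> lborel \<and> distr \<Omega> borel Z = N \<and> (\<forall>x\<in>space \<Omega>. (\<lambda>n. X n x) \<longlonglongrightarrow> Z x)"
    by (elim exE) (rule that)
  then have \<Omega>: "prob_space \<Omega>" and X: "\<And>n. X n \<in> borel_measurable \<Omega>"
    and dX: "\<And>n. distr \<Omega> borel (X n) = \<mu> n"
    and Z: "Z \<in> borel_measurable \<Omega>" and dZ: "distr \<Omega> borel Z = N"
    and lim: "\<And>x. x \<in> space \<Omega> \<Longrightarrow> (\<lambda>n. X n x) \<longlonglongrightarrow> Z x"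
    by (simp_all add: measurable_lborel2)
  interpret prob_space \<Omega> by fact
  have h_meas: "h n \<in> borel_measurable borel" for n
    using lip by (intro borel_measurable_continuous_onI lipschitz_on_continuous_on)
  note hX = measurable_compose[OF X h_meas] and hZ = measurable_compose[OF Z h_meas]
  have "(\<lambda>n. LINT x|\<Omega>. h n (X n x) - h n (Z x)) \<longlonglongrightarrow> (LINT x|\<Omega>. 0)"
  proof (rule integral_dominated_convergence[where w="\<lambda>_. 2"])
    show "AE x in \<Omega>. (\<lambda>n. h n (X n x) - h n (Z x)) \<longlonglongrightarrow> 0"
    proof (rule AE_I2)
      fix x assume "x \<in> space \<Omega>"
      from tendsto_rabs_zero[OF LIM_zero[OF lim[OF this]]]
      have "(\<lambda>n. \<bar>X n x - Z x\<bar>) \<longlonglongrightarrow> 0" .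
      then show "(\<lambda>n. h n (X n x) - h n (Z x)) \<longlonglongrightarrow> 0"
      proof (rule Lim_null_comparison[rotated])
        have "norm (h n (X n x) - h n (Z x)) \<le> \<bar>X n x - Z x\<bar>" for n
          using lipschitz_onD[OF lip, of "X n x" "Z x" n] by (simp add: dist_real_def)
        then show "eventually (\<lambda>n. norm (h n (X n x) - h n (Z x)) \<le> \<bar>X n x - Z x\<bar>) sequentially"
          by (rule always_eventually[OF allI])
      qed
    qed
    show "AE x in \<Omega>. norm (h n (X n x) - h n (Z x)) \<le> 2" for n
    proof (rule AE_I2)
      fix x
      show "norm (h n (X n x) - h n (Z x)) \<le> 2"
        using bd[of n "X n x"] bd[of n "Z x"] by simp
    qed
  qed (use hX hZ in simp_all)
  moreover have "(LINT x|\<Omega>. h n (X n x) - h n (Z x)) = (LINT x|\<mu> n. h n x) - (LINT x|N. h n x)" for n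
  proof -
    have "integrable \<Omega> (\<lambda>x. h n (X n x))" "integrable \<Omega> (\<lambda>x. h n (Z x))"
      using bd hX hZ by (intro integrable_const_bound[where B=1]; simp)+
    then show ?thesis
      unfolding dX[symmetric] dZ[symmetric]
      by (simp add: integral_distr[OF X h_meas] integral_distr[OF Z h_meas])
  qed
  ultimately show ?thesis by simp
qed

text \<open>A finite set of arguments suffices: otherwise a sequence of counterexamples along an enumeration
  of the rationals would converge weakly. Convergence in probability of the Laplace transform at each
  argument can thus be used through a finite union of events, without passing to subsequences.\<close>

theorem mgf_close_imp_lipschitz_close:
  assumes N: "real_distribution N"
    and intN: "\<And>t::real. integrable N (\<lambda>x. exp (t * x))" and \<eta>: "\<eta> > 0"
  shows "\<exists>T \<delta>. finite T \<and> \<delta> > 0 \<and> (\<forall>\<mu> (h :: real \<Rightarrow> real). real_distribution \<mu> \<longrightarrow>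
     (\<forall>t\<in>T. \<bar>(LINT x|\<mu>. exp (t * x)) - (LINT x|N. exp (t * x))\<bar> < \<delta>) \<longrightarrow>
     1-lipschitz_on UNIV h \<longrightarrow> (\<forall>x. \<bar>h x\<bar> \<le> 1) \<longrightarrow> \<bar>(LINT x|\<mu>. h x) - (LINT x|N. h x)\<bar> < \<eta>)"
proof (rule ccontr)
  interpret N: real_distribution N by fact
  define L where "L t = (LINT x|N. exp (t * x))" for t :: real
  have L: "L t > 0" for t
    using N.integral_less_AE_space[of "\<lambda>_. 0" "\<lambda>x. exp (t * x)"] intN[of t] N.emeasure_space_1 by (simp add: L_def)
  define T :: "nat \<Rightarrow> real set" where "T m = {1, -1} \<union> from_nat_into \<rat> ` {..m}" for m
  \<comment> \<open>The cap by \<open>L 1\<close> and \<open>L (-1)\<close> keeps the transforms at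
    \<open>1\<close> and \<open>-1\<close>, which lie in every \<open>T m\<close>, away from zero.
    The two exponentials are then integrable for every \<open>m\<close>, as the convergence theorem
    demands.\<close>
  define \<delta> where "\<delta> m = min (1 / real (Suc m)) (min (L 1) (L (-1)))" for m
  assume no: "\<not> ?thesis"
  define Q where "Q m \<mu> h \<longleftrightarrow> real_distribution \<mu> \<and> (\<forall>t\<in>T m. \<bar>(LINT x|\<mu>. exp (t * x)) - L t\<bar> < \<delta> m) \<and>
     1-lipschitz_on UNIV h \<and> (\<forall>x. \<bar>h x\<bar> \<le> 1) \<and> \<not> \<bar>(LINT x|\<mu>. h x) - (LINT x|N. h x)\<bar> < \<eta>" for m \<mu> and h :: "real \<Rightarrow> real"
  have "\<exists>\<mu> h. Q m \<mu> h" for m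
  proof -
    have "finite (T m)" "\<delta> m > 0" by (auto simp: T_def \<delta>_def L)
    with no show ?thesis
      unfolding Q_def L_def by blast
  qed
  then obtain \<mu> h where Q: "\<And>m. Q m (\<mu> m) (h m)" by metis
  have \<mu>: "real_distribution (\<mu> m)" and h: "1-lipschitz_on UNIV (h m)" "\<bar>h m x\<bar> \<le> 1"
    and far: "\<not> \<bar>(LINT x|\<mu> m. h m x) - (LINT x|N. h m x)\<bar> < \<eta>" for m x
    using Q[of m] by (auto simp: Q_def)
  have close: "\<bar>(LINT x|\<mu> m. exp (t * x)) - L t\<bar> < \<delta> m" if "t \<in> T m" for m t
    using Q[of m] that by (auto simp: Q_def)
  have "integrable (\<mu> m) (\<lambda>x. exp (t * x))" if "t \<in> {1, -1}" for m t
  proof (rule ccontr)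
    assume "\<not> ?thesis"
    then have "(LINT x|\<mu> m. exp (t * x)) = 0" by (rule not_integrable_integral_eq)
    with close[of t m] that show False by (auto simp: T_def \<delta>_def)
  qed
  from this[of 1] this[of "-1"] have "weak_conv_m \<mu> N"
  proof (intro mgf_convergence_imp_weak_conv \<mu> N intN)
    fix t :: real assume "t \<in> \<rat>"
    then obtain i where i: "t = from_nat_into \<rat> i"
      by (metis countable_rat from_nat_into_surj)
    have "(\<lambda>n. \<bar>(LINT x|\<mu> n. exp (t * x)) - L t\<bar>) \<longlonglongrightarrow> 0"
    proof (rule tendsto_sandwich[OF _ _ tendsto_const])
      show "eventually (\<lambda>n. \<bar>(LINT x|\<mu> n. exp (t * x)) - L t\<bar> \<le> 1 / real (Suc n)) sequentially"
        using eventually_ge_at_top[of i]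
      proof eventually_elim
        case (elim n)
        then have "t \<in> T n" by (auto simp: T_def i)
        from close[OF this] show ?case by (simp add: \<delta>_def)
      qed
      show "(\<lambda>n. 1 / real (Suc n)) \<longlonglongrightarrow> 0"
        using LIMSEQ_inverse_real_of_nat by (simp add: inverse_eq_divide)
    qed simp
    then show "(\<lambda>n. LINT x|\<mu> n. exp (t * x)) \<longlonglongrightarrow> (LINT x|N. exp (t * x))"
      by (simp add: tendsto_rabs_zero_iff LIM_zero_iff L_def)
  qed auto
  then have "(\<lambda>m. (LINT x|\<mu> m. h m x) - (LINT x|N. h m x)) \<longlonglongrightarrow> 0"
    by (intro weak_conv_uniform_lipschitz[where \<mu>=\<mu> and N=N and h=h] \<mu> N h)
  then have "eventually (\<lambda>m. \<bar>(LINT x|\<mu> m. h m x) - (LINT x|N. h m x)\<bar> < \<eta>) sequentially"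
    by (intro order_tendstoD(2)[OF tendsto_rabs_zero] \<eta>)
  with far show False by simp
qed

section \<open>Almost sure convergence of Gaussian series\<close>

text \<open>Freezing the partial sums once they leave $(-l, l)$ keeps the second moment below the sum of the
  variances, so that Chebyshev's inequality for the frozen sum controls the maximum.\<close>

fun stopped_sum :: "real \<Rightarrow> (nat \<Rightarrow> real) \<Rightarrow> nat \<Rightarrow> real" where
  "stopped_sum l x 0 = 0"
| "stopped_sum l x (Suc n) = stopped_sum l x n + (if \<bar>stopped_sum l x n\<bar> < l then x n else 0)"

lemma stopped_sum_lessD:
  "\<bar>stopped_sum l x n\<bar> < l \<Longrightarrow> stopped_sum l x n = (\<Sum>i<n. x i) \<and> (\<forall>j\<le>n. \<bar>\<Sum>i<j. x i\<bar> < l)"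
  by (induction n) (auto simp: le_Suc_eq split: if_splits)

lemma stopped_sum_cong: "(\<And>i. i < n \<Longrightarrow> x i = y i) \<Longrightarrow> stopped_sum l x n = stopped_sum l y n"
  by (induction n) auto

lemma measurable_stopped_sum:
  "n \<le> m \<Longrightarrow> (\<lambda>x. stopped_sum l x n) \<in> borel_measurable (Pi\<^sub>M {..<m} (\<lambda>_. borel))"
  by (induction n) auto

context prob_space
begin

text \<open>The cross term of the new square is \<open>2 * (g (V \<omega>) * X n \<omega>)\<close>.
  It has mean zero because \<open>g (V \<omega>)\<close> is bounded and depends only on variables
  with index below \<open>n\<close>. Only an inequality results, since the square of
  \<open>X n\<close> is counted even after freezing.\<close>

lemma stopped_sum_second_moment:
  fixes X :: "nat \<Rightarrow> 'a \<Rightarrow> real"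
  assumes indep: "indep_vars (\<lambda>_. borel) X UNIV"
    and sq: "\<And>i. integrable M (\<lambda>\<omega>. (X i \<omega>)\<^sup>2)" and mean: "\<And>i. expectation (X i) = 0"
    and X[measurable]: "\<And>i. X i \<in> borel_measurable M"
  shows "(\<lambda>\<omega>. stopped_sum l (\<lambda>i. X i \<omega>) n) \<in> borel_measurable M \<and>
    integrable M (\<lambda>\<omega>. (stopped_sum l (\<lambda>i. X i \<omega>) n)\<^sup>2) \<and>
    expectation (\<lambda>\<omega>. (stopped_sum l (\<lambda>i. X i \<omega>) n)\<^sup>2) \<le> (\<Sum>i<n. expectation (\<lambda>\<omega>. (X i \<omega>)\<^sup>2))"
proof (induction n)
  case 0
  show ?case by simp
next
  case (Suc n)
  define V where "V \<omega> = stopped_sum l (\<lambda>i. X i \<omega>) n" for \<omega>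
  define g :: "real \<Rightarrow> real" where "g v = (if \<bar>v\<bar> < l then v else 0)" for v
  have V[measurable]: "V \<in> borel_measurable M"
    and V2: "integrable M (\<lambda>\<omega>. (V \<omega>)\<^sup>2)" "expectation (\<lambda>\<omega>. (V \<omega>)\<^sup>2) \<le> (\<Sum>i<n. expectation (\<lambda>\<omega>. (X i \<omega>)\<^sup>2))"
    using Suc by (auto simp: V_def[abs_def])
  have g[measurable]: "g \<in> borel_measurable borel"
    unfolding g_def by measurable
  have intX: "integrable M (X n)"
    by (rule square_integrable_imp_integrable[OF X sq])
  have intg: "integrable M (\<lambda>\<omega>. g (V \<omega>))"
    by (rule integrable_const_bound[where B="\<bar>l\<bar>"]) (auto simp: g_def)
  have "indep_var borel ((\<lambda>x. g (stopped_sum l x n)) \<circ> (\<lambda>\<omega>. restrict (\<lambda>i. X i \<omega>) {..<n}))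
      borel ((\<lambda>x. x n) \<circ> (\<lambda>\<omega>. restrict (\<lambda>i. X i \<omega>) {n}))"
    by (intro indep_var_compose[OF indep_var_restrict[OF indep]])
       (use measurable_stopped_sum[of n n l] in auto)
  also have "(\<lambda>x. g (stopped_sum l x n)) \<circ> (\<lambda>\<omega>. restrict (\<lambda>i. X i \<omega>) {..<n}) = (\<lambda>\<omega>. g (V \<omega>))"
    by (auto simp: fun_eq_iff V_def intro!: arg_cong[where f=g] stopped_sum_cong)
  also have "(\<lambda>x. x n) \<circ> (\<lambda>\<omega>. restrict (\<lambda>i. X i \<omega>) {n}) = X n"
    by (auto simp: fun_eq_iff)
  finally have ind: "indep_var borel (\<lambda>\<omega>. g (V \<omega>)) borel (X n)" .
  have cross: "integrable M (\<lambda>\<omega>. g (V \<omega>) * X n \<omega>)" "expectation (\<lambda>\<omega>. g (V \<omega>) * X n \<omega>) = 0"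
    using indep_var_integrable[OF ind intg intX] indep_var_lebesgue_integral[OF ind intg intX] mean by auto
  have eq: "stopped_sum l (\<lambda>i. X i \<omega>) (Suc n) = V \<omega> + (if \<bar>V \<omega>\<bar> < l then X n \<omega> else 0)" for \<omega>
    by (simp add: V_def)
  let ?B = "\<lambda>\<omega>. (V \<omega>)\<^sup>2 + 2 * (g (V \<omega>) * X n \<omega>) + (X n \<omega>)\<^sup>2"
  have intB: "integrable M ?B"
    using V2 cross sq by auto
  have le: "(stopped_sum l (\<lambda>i. X i \<omega>) (Suc n))\<^sup>2 \<le> ?B \<omega>" for \<omega>
    unfolding eq by (auto simp: g_def power2_sum)
  have meas: "(\<lambda>\<omega>. stopped_sum l (\<lambda>i. X i \<omega>) (Suc n)) \<in> borel_measurable M"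
    unfolding eq by measurable
  have int: "integrable M (\<lambda>\<omega>. (stopped_sum l (\<lambda>i. X i \<omega>) (Suc n))\<^sup>2)"
  proof (rule Bochner_Integration.integrable_bound[OF intB])
    show "AE \<omega> in M. norm ((stopped_sum l (\<lambda>i. X i \<omega>) (Suc n))\<^sup>2) \<le> norm (?B \<omega>)"
      using le by (intro AE_I2) (metis abs_ge_self norm_ge_zero order_trans real_norm_def abs_of_nonneg zero_le_power2)
  qed (use meas in measurable)
  have "expectation (\<lambda>\<omega>. (stopped_sum l (\<lambda>i. X i \<omega>) (Suc n))\<^sup>2) \<le> expectation ?B"
    by (intro integral_mono int intB le)
  also have "\<dots> \<le> (\<Sum>i<Suc n. expectation (\<lambda>\<omega>. (X i \<omega>)\<^sup>2))"
    using V2 cross sq[of n] by simp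
  finally show ?case using meas int by blast
qed

theorem Kolmogorov_maximal_inequality:
  fixes X :: "nat \<Rightarrow> 'a \<Rightarrow> real"
  assumes indep: "indep_vars (\<lambda>_. borel) X UNIV"
    and sq: "\<And>i. integrable M (\<lambda>\<omega>. (X i \<omega>)\<^sup>2)" and mean: "\<And>i. expectation (X i) = 0"
    and l: "l > 0"
  shows "prob {\<omega>\<in>space M. \<exists>j\<le>n. l \<le> \<bar>\<Sum>i<j. X i \<omega>\<bar>} \<le> (\<Sum>i<n. expectation (\<lambda>\<omega>. (X i \<omega>)\<^sup>2)) / l\<^sup>2"
proof -
  have X: "X i \<in> borel_measurable M" for i
    using indep by (auto simp: indep_vars_def)
  note V = stopped_sum_second_moment[OF indep sq mean X, of l n]
  have [measurable]: "(\<lambda>\<omega>. stopped_sum l (\<lambda>i. X i \<omega>) n) \<in> borel_measurable M"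
    using V by blast
  have "prob {\<omega>\<in>space M. \<exists>j\<le>n. l \<le> \<bar>\<Sum>i<j. X i \<omega>\<bar>} \<le> prob {\<omega>\<in>space M. l \<le> \<bar>stopped_sum l (\<lambda>i. X i \<omega>) n\<bar>}"
  proof (rule finite_measure_mono)
    show "{\<omega>\<in>space M. \<exists>j\<le>n. l \<le> \<bar>\<Sum>i<j. X i \<omega>\<bar>} \<subseteq> {\<omega>\<in>space M. l \<le> \<bar>stopped_sum l (\<lambda>i. X i \<omega>) n\<bar>}"
      using stopped_sum_lessD by (fastforce simp: not_less[symmetric])
  qed measurable
  also have "\<dots> \<le> expectation (\<lambda>\<omega>. (stopped_sum l (\<lambda>i. X i \<omega>) n)\<^sup>2) / l\<^sup>2"
    using V l by (intro second_moment_method) auto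
  also have "\<dots> \<le> (\<Sum>i<n. expectation (\<lambda>\<omega>. (X i \<omega>)\<^sup>2)) / l\<^sup>2"
    using V by (intro divide_right_mono) auto
  finally show ?thesis .
qed

text \<open>This is Cauchy's criterion: the maximal inequality for the terms from \<open>N\<close>
  on bounds the probability of a block sum of size \<open>l\<close> by
  \<open>r N / l\<^sup>2\<close>, where \<open>r N\<close> is the remainder of the variance series
  and tends to zero.\<close>

theorem AE_summable_independent:
  fixes X :: "nat \<Rightarrow> 'a \<Rightarrow> real"
  assumes indep: "indep_vars (\<lambda>_. borel) X UNIV"
    and sq: "\<And>i. integrable M (\<lambda>\<omega>. (X i \<omega>)\<^sup>2)" and mean: "\<And>i. expectation (X i) = 0"
    and sm: "summable (\<lambda>i. expectation (\<lambda>\<omega>. (X i \<omega>)\<^sup>2))"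
  shows "AE \<omega> in M. summable (\<lambda>i. X i \<omega>)"
proof -
  define v where "v i = expectation (\<lambda>\<omega>. (X i \<omega>)\<^sup>2)" for i
  have v: "v i \<ge> 0" for i by (simp add: v_def)
  define r where "r N = suminf v - (\<Sum>i<N. v i)" for N
  have r: "r \<longlonglongrightarrow> 0"
    unfolding r_def using summable_LIMSEQ[OF sm] by (auto simp: v_def[abs_def] intro!: tendsto_eq_intros)
  have [measurable]: "X i \<in> borel_measurable M" for i
    using indep by (auto simp: indep_vars_def)
  define B where "B N l n = {\<omega>\<in>space M. \<exists>j\<le>n. l \<le> \<bar>\<Sum>i\<in>{N..<j}. X i \<omega>\<bar>}" for N n and l :: real
  have B_meas [measurable]: "B N l n \<in> sets M" for N l n
    unfolding B_def by measurable
  have B_le: "prob (B N l n) \<le> r N / l\<^sup>2" if l: "l > 0" for N l n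
  proof -
    \<comment> \<open>Zeroing the first \<open>N\<close> terms lets the maximal inequality, which
      concerns sums starting at index zero, speak of blocks starting at \<open>N\<close>.\<close>
    define X' where "X' i \<omega> = (if i < N then 0 else X i \<omega>)" for i \<omega>
    have sum_eq: "(\<Sum>i<j. X' i \<omega>) = (\<Sum>i\<in>{N..<j}. X i \<omega>)" for j \<omega>
      by (rule sum.mono_neutral_cong_right) (auto simp: X'_def)
    have v': "expectation (\<lambda>\<omega>. (X' i \<omega>)\<^sup>2) = (if i < N then 0 else v i)" for i
      by (simp add: X'_def v_def)
    have "prob {\<omega>\<in>space M. \<exists>j\<le>n. l \<le> \<bar>\<Sum>i<j. X' i \<omega>\<bar>} \<le> (\<Sum>i<n. expectation (\<lambda>\<omega>. (X' i \<omega>)\<^sup>2)) / l\<^sup>2"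
    proof (rule Kolmogorov_maximal_inequality)
      have "indep_vars (\<lambda>_. borel) (\<lambda>i \<omega>. (\<lambda>x. if i < N then 0 else x) (X i \<omega>)) UNIV"
        by (rule indep_vars_compose2[where M'="\<lambda>_. borel" and X=X and Y="\<lambda>i x. if i < N then 0 else x", OF indep]) auto
      then show "indep_vars (\<lambda>_. borel) X' UNIV"
        by (simp add: X'_def[abs_def])
      show "integrable M (\<lambda>\<omega>. (X' i \<omega>)\<^sup>2)" "expectation (X' i) = 0" for i
        using sq[of i] mean[of i] by (cases "i < N"; simp add: X'_def[abs_def])+
    qed (rule l)
    also have "(\<Sum>i<n. expectation (\<lambda>\<omega>. (X' i \<omega>)\<^sup>2)) \<le> r N"
    proof -
      \<comment> \<open>The range is extended to \<open>N+n\<close> so that it is a difference of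
        two partial sums even when \<open>n < N\<close>.\<close>
      have "(\<Sum>i<n. expectation (\<lambda>\<omega>. (X' i \<omega>)\<^sup>2)) \<le> (\<Sum>i\<in>{N..<N+n}. v i)"
      proof -
        have "(\<Sum>i<n. expectation (\<lambda>\<omega>. (X' i \<omega>)\<^sup>2)) = (\<Sum>i\<in>{N..<n}. v i)"
          unfolding v' by (rule sum.mono_neutral_cong_right) auto
        also have "\<dots> \<le> (\<Sum>i\<in>{N..<N+n}. v i)"
          by (rule sum_mono2) (auto simp: v)
        finally show ?thesis .
      qed
      also have "\<dots> = (\<Sum>i<N+n. v i) - (\<Sum>i<N. v i)"
        by (simp add: lessThan_atLeast0 sum_diff_nat_ivl)
      also have "\<dots> \<le> r N"
        unfolding r_def using sum_le_suminf[OF sm, of "{..<N+n}"] v by (simp add: v_def[abs_def])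
      finally show ?thesis .
    qed
    finally show ?thesis
      by (simp add: sum_eq B_def divide_right_mono)
  qed
  have Un_le: "prob (\<Union>n. B N l n) \<le> r N / l\<^sup>2" if l: "l > 0" for N l
  proof (rule LIMSEQ_le_const2)
    show "(\<lambda>n. prob (B N l n)) \<longlonglongrightarrow> prob (\<Union>n. B N l n)"
      by (intro finite_Lim_measure_incseq) (auto simp: incseq_def B_def, meson le_trans)
  qed (use B_le[OF l] in auto)
  have null: "AE \<omega> in M. \<omega> \<notin> (\<Inter>N. \<Union>n. B N l n)" if l: "l > 0" for l
  proof -
    have "prob (\<Inter>N. \<Union>n. B N l n) \<le> 0"
    proof (rule LIMSEQ_le_const)
      show "(\<lambda>N. r N / l\<^sup>2) \<longlonglongrightarrow> 0"
        using tendsto_divide[OF r tendsto_const, of "l\<^sup>2"] l by simp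
      have "prob (\<Inter>N. \<Union>n. B N l n) \<le> r N / l\<^sup>2" for N
        by (rule order_trans[OF finite_measure_mono Un_le[OF l]]) auto
      then show "\<exists>N. \<forall>n\<ge>N. prob (\<Inter>N. \<Union>n. B N l n) \<le> r n / l\<^sup>2" by blast
    qed
    then have "(\<Inter>N. \<Union>n. B N l n) \<in> null_sets M"
      by (auto simp: null_sets_def emeasure_eq_measure measure_le_0_iff)
    then show ?thesis by (rule AE_not_in)
  qed
  \<comment> \<open>Countably many levels \<open>1 / real (Suc k)\<close> serve all tolerances with
    one null set.\<close>
  have "AE \<omega> in M. \<forall>k. \<omega> \<notin> (\<Inter>N. \<Union>n. B N (1 / real (Suc k)) n)"
    unfolding AE_all_countable by (intro allI null) simp
  then show ?thesis
  proof (rule AE_mp, intro AE_I2 impI)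
    fix \<omega> assume \<omega>: "\<omega> \<in> space M" and out: "\<forall>k. \<omega> \<notin> (\<Inter>N. \<Union>n. B N (1 / real (Suc k)) n)"
    have *: "\<exists>N. \<forall>j. \<bar>\<Sum>i\<in>{N..<j}. X i \<omega>\<bar> < 1 / real (Suc k)" for k
    proof -
      obtain N where N: "\<And>j. \<omega> \<notin> B N (1 / real (Suc k)) j" using out by blast
      have "\<bar>\<Sum>i\<in>{N..<j}. X i \<omega>\<bar> < 1 / real (Suc k)" for j
        using N[of j] \<omega> unfolding B_def by (auto simp: not_le simp del: of_nat_Suc)
      then show ?thesis by blast
    qed
    show "summable (\<lambda>i. X i \<omega>)"
      unfolding summable_Cauchy
    proof (intro allI impI)
      fix e :: real assume "e > 0"
      \<comment> \<open>Half the tolerance, because a block from \<open>m\<close> to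
        \<open>n\<close> is the difference of two blocks that start at \<open>N\<close>.\<close>
      then obtain k where k: "1 / real (Suc k) < e / 2" using nat_approx_posE[of "e/2"] by auto
      from * obtain N where N: "\<And>j. \<bar>\<Sum>i\<in>{N..<j}. X i \<omega>\<bar> < 1 / real (Suc k)" by blast
      have "norm (\<Sum>i\<in>{m..<n}. X i \<omega>) < e" if "m \<ge> N" for m n
      proof (cases "m \<le> n")
        case True
        then have "(\<Sum>i\<in>{m..<n}. X i \<omega>) = (\<Sum>i\<in>{N..<n}. X i \<omega>) - (\<Sum>i\<in>{N..<m}. X i \<omega>)"
          using that by (simp add: sum_diff_nat_ivl)
        then show ?thesis using N[of m] N[of n] k by simp
      qed (use \<open>e > 0\<close> in simp)
      then show "\<exists>N. \<forall>m\<ge>N. \<forall>n. norm (\<Sum>i\<in>{m..<n}. X i \<omega>) < e" by blast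
    qed
  qed
qed

lemma AE_summable_gaussian_series:
  assumes iid: "iid_std_normal M \<epsilon>" and c: "summable (\<lambda>k. (c k)\<^sup>2)"
  shows "AE \<omega> in M. summable (\<lambda>k. c k * \<epsilon> k \<omega>)"
proof (rule AE_summable_independent)
  have D: "distributed M lborel (\<epsilon> k) (\<lambda>x. ennreal (std_normal_density x))" for k
    using iid by (auto simp: iid_std_normal_def)
  have "indep_vars (\<lambda>_. borel) (\<lambda>k \<omega>. (\<lambda>x. c k * x) (\<epsilon> k \<omega>)) UNIV"
    by (rule indep_vars_compose2[where M'="\<lambda>_. borel" and X=\<epsilon> and Y="\<lambda>k x. c k * x"])
       (use iid in \<open>auto simp: iid_std_normal_def\<close>)
  then show "indep_vars (\<lambda>_. borel) (\<lambda>k \<omega>. c k * \<epsilon> k \<omega>) UNIV" by simp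
  have e2: "integrable M (\<lambda>\<omega>. (\<epsilon> k \<omega>)\<^sup>2)" for k
    using distributed_integrable[OF D, of "\<lambda>x. x\<^sup>2" k] integrable_std_normal_moment[of 2] by simp
  have e1: "expectation (\<epsilon> k) = 0" for k
    by (rule standard_normal_distributed_expectation[OF D])
  have e2': "expectation (\<lambda>\<omega>. (\<epsilon> k \<omega>)\<^sup>2) = 1" for k
    using standard_normal_distributed_variance[OF D, of k] e1[of k] by simp
  show "integrable M (\<lambda>\<omega>. (c k * \<epsilon> k \<omega>)\<^sup>2)" "expectation (\<lambda>\<omega>. c k * \<epsilon> k \<omega>) = 0" for k
    using e2[of k] e1[of k] by (auto simp: power_mult_distrib)
  show "summable (\<lambda>k. expectation (\<lambda>\<omega>. (c k * \<epsilon> k \<omega>)\<^sup>2))"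
    using c by (simp add: power_mult_distrib e2')
qed

end

section \<open>Orthonormal expansions and noise series over the prior\<close>

text \<open>The partial sum maps \<open>S N\<close> are linear contractions by Bessel's inequality,
  and each element of the span is eventually fixed by them; density carries the convergence over to
  every \<open>f\<close>. The limit is known in advance, so the argument avoids Cauchy sequences and
  works in incomplete spaces.\<close>

lemma orthonormal_expansion:
  fixes \<phi> :: "nat \<Rightarrow> 'a::real_inner"
  assumes on: "\<And>j k. inner (\<phi> j) (\<phi> k) = (if j = k then 1 else 0)" and dense: "closure (span (range \<phi>)) = UNIV"
  shows "(\<lambda>k. inner f (\<phi> k) *\<^sub>R \<phi> k) sums f"
proof -
  define S where "S N f = (\<Sum>k<N. inner f (\<phi> k) *\<^sub>R \<phi> k)" for N f
  have S_diff: "S N (f - g) = S N f - S N g" and S_add: "S N (f + g) = S N f + S N g"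
    and S_scale: "S N (c *\<^sub>R f) = c *\<^sub>R S N f" for N f g c
    by (simp_all add: S_def inner_diff_left inner_add_left scaleR_left_diff_distrib scaleR_left_distrib
        sum_subtractf sum.distrib scaleR_sum_right)
  have bessel: "norm (S N f) \<le> norm f" for N f
  proof -
    have "inner (S N f) (S N f) = (\<Sum>k<N. (inner f (\<phi> k))\<^sup>2)"
      by (simp add: S_def inner_sum_left inner_sum_right on power2_eq_square if_distrib sum.delta' cong: if_cong)
    also have "\<dots> = inner f (S N f)"
      by (simp add: S_def inner_sum_right power2_eq_square)
    also have "\<dots> \<le> norm f * norm (S N f)" by (rule norm_cauchy_schwarz)
    finally have "norm (S N f) * norm (S N f) \<le> norm f * norm (S N f)"
      by (simp add: power2_norm_eq_inner[symmetric] power2_eq_square)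
    then show ?thesis
      by (cases "norm (S N f) = 0") (simp_all add: mult_le_cancel_right)
  qed
  have span: "\<exists>N0. \<forall>N\<ge>N0. S N g = g" if "g \<in> span (range \<phi>)" for g
    using that
  proof (induction rule: span_induct_alt)
    case base
    then show ?case by (simp add: S_def)
  next
    case (step c x y)
    then obtain j N0 where j: "x = \<phi> j" and N0: "\<And>N. N \<ge> N0 \<Longrightarrow> S N y = y" by auto
    have "S N x = x" if "N > j" for N
      using that by (simp add: S_def j on if_distrib if_distribR sum.delta cong: if_cong)
    then have "S N (c *\<^sub>R x + y) = c *\<^sub>R x + y" if "N \<ge> max (Suc j) N0" for N
      using that N0 by (simp add: S_add S_scale)
    then show ?case by blast
  qed
  have "(\<lambda>N. S N f) \<longlonglongrightarrow> f"
  proof (rule LIMSEQ_I)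
    fix e :: real assume e: "e > 0"
    have "f \<in> closure (span (range \<phi>))" by (simp add: dense)
    then obtain g where g: "g \<in> span (range \<phi>)" "dist g f < e / 2"
      using e by (auto simp: closure_approachable dest: spec[of _ "e/2"])
    obtain N0 where N0: "\<And>N. N \<ge> N0 \<Longrightarrow> S N g = g" using span[OF g(1)] by blast
    have "norm (S N f - f) < e" if "N \<ge> N0" for N
    proof -
      have "S N f - f = S N (f - g) - (f - g)" using N0[OF that] by (simp add: S_diff)
      then have "norm (S N f - f) \<le> norm (S N (f - g)) + norm (f - g)"
        by (metis norm_triangle_ineq4)
      also have "\<dots> < e" using bessel[of N "f - g"] g(2) by (simp add: dist_norm norm_minus_commute)
      finally show ?thesis .
    qed
    then show "\<exists>N0. \<forall>N\<ge>N0. norm (S N f - f) < e" by blast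
  qed
  then show ?thesis by (simp add: sums_def S_def)
qed

lemma Parseval:
  assumes "orthonormal_basis \<phi>"
  shows "(\<lambda>k. inner f (\<phi> k) * inner g (\<phi> k)) sums inner f g"
proof -
  have "(\<lambda>k. inner f (\<phi> k) *\<^sub>R \<phi> k) sums f"
    using assms by (intro orthonormal_expansion) (auto simp: orthonormal_basis_def)
  from bounded_linear.sums[OF bounded_linear_inner_left this, of g]
  show ?thesis by (simp add: inner_commute[of g])
qed

lemma summable_square_coeffs: "orthonormal_basis \<phi> \<Longrightarrow> summable (\<lambda>k. (inner f (\<phi> k))\<^sup>2)"
  using sums_summable[OF Parseval[of \<phi> f f]] by (simp add: power2_eq_square)

text \<open>The series in the log-likelihood converges almost surely for each fixed $f$, but not for all $f$
  simultaneously, and where it diverges \<^const>\<open>suminf\<close> is a junk value that is not linear in $f$.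
  By Fubini, for almost every noise the exceptional $f$ form a null set of the prior.\<close>

lemma AE_prior_summable:
  assumes "prob_space P" and iid: "iid_std_normal P \<epsilon>" and \<phi>: "orthonormal_basis \<phi>"
    and "prob_space p" and sets: "sets p = sets borel"
  shows "AE \<omega> in P. AE f in p. summable (\<lambda>k. inner f (\<phi> k) * \<epsilon> k \<omega>)"
proof -
  interpret P: prob_space P by fact
  interpret p: prob_space p by fact
  interpret pair_sigma_finite P p ..
  have [measurable_cong]: "sets p = sets borel" by fact
  have [measurable]: "\<epsilon> k \<in> borel_measurable P" for k
    using iid by (auto simp: iid_std_normal_def P.indep_vars_def)
  have [measurable]: "(\<lambda>f. inner f (\<phi> k)) \<in> borel_measurable borel" for k
    by (intro borel_measurable_continuous_onI continuous_intros)
  have [measurable]: "(\<lambda>x. \<Sum>k<n. inner (snd x) (\<phi> k) * \<epsilon> k (fst x)) \<in> borel_measurable (P \<Otimes>\<^sub>M p)" for n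
    by measurable
  \<comment> \<open>Exchanging the two almost-everywhere quantifiers needs a set measurable in the
    product; convergence is expressed as the Cauchy property to obtain this.\<close>
  have "{x \<in> space (P \<Otimes>\<^sub>M p). Cauchy (\<lambda>n. \<Sum>k<n. inner (snd x) (\<phi> k) * \<epsilon> k (fst x))} \<in> sets (P \<Otimes>\<^sub>M p)"
    by measurable
  then have "{x \<in> space (P \<Otimes>\<^sub>M p). summable (\<lambda>k. inner (snd x) (\<phi> k) * \<epsilon> k (fst x))} \<in> sets (P \<Otimes>\<^sub>M p)"
    by (simp add: summable_iff_convergent Cauchy_convergent_iff)
  then show ?thesis
    by (subst AE_commute) (use P.AE_summable_gaussian_series[OF iid summable_square_coeffs[OF \<phi>]] in auto)
qed

section \<open>Tempered posteriors\<close>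

text \<open>The events in question may fail to be measurable, so subadditivity is taken from
  measurable covers that attain the outer measures.\<close>

lemma outer_measure_of_Un_le:
  assumes "A \<subseteq> space M" "B \<subseteq> space M"
  shows "outer_measure_of M (A \<union> B) \<le> outer_measure_of M A + outer_measure_of M B"
proof -
  obtain E F where E: "E \<in> sets M" "A \<subseteq> E" "outer_measure_of M A = emeasure M E"
    and F: "F \<in> sets M" "B \<subseteq> F" "outer_measure_of M B = emeasure M F"
    using outer_measure_of_attain assms by metis
  have "outer_measure_of M (A \<union> B) \<le> outer_measure_of M (E \<union> F)"
    using E F by (intro outer_measure_of_mono) auto
  also have "\<dots> \<le> emeasure M E + emeasure M F"
    using E F by (simp add: emeasure_subadditive)
  finally show ?thesis using E F by simp
qed

lemma tendsto_outer_measure_Un: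
  assumes "\<And>n. A n \<subseteq> space M" "\<And>n. B n \<subseteq> space M"
    and "(\<lambda>n. outer_measure_of M (A n)) \<longlonglongrightarrow> 0" "(\<lambda>n. outer_measure_of M (B n)) \<longlonglongrightarrow> 0"
  shows "(\<lambda>n. outer_measure_of M (A n \<union> B n)) \<longlonglongrightarrow> 0"
proof (rule tendsto_sandwich[OF _ _ tendsto_const])
  show "(\<lambda>n. outer_measure_of M (A n) + outer_measure_of M (B n)) \<longlonglongrightarrow> 0"
    using tendsto_add[OF assms(3,4)] by simp
qed (auto intro!: always_eventually outer_measure_of_Un_le assms)

lemma tendsto_outer_measure_UN:
  assumes "finite T" and "\<And>t n. t \<in> T \<Longrightarrow> A t n \<subseteq> space M"
    and "\<And>t. t \<in> T \<Longrightarrow> (\<lambda>n. outer_measure_of M (A t n)) \<longlonglongrightarrow> 0"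
  shows "(\<lambda>n. outer_measure_of M (\<Union>t\<in>T. A t n)) \<longlonglongrightarrow> 0"
  using assms
proof (induction T rule: finite_induct)
  case (insert t T)
  then have "(\<lambda>n. outer_measure_of M (A t n \<union> (\<Union>t\<in>T. A t n))) \<longlonglongrightarrow> 0"
    by (intro tendsto_outer_measure_Un) auto
  then show ?case by simp
qed simp

section \<open>The log-likelihood and its shift\<close>

lemma borel_measurable_loglik [measurable]: "loglik \<phi> n y \<in> borel_measurable borel"
proof -
  have [measurable]: "(\<lambda>f. inner f (\<phi> k)) \<in> borel_measurable borel" for k
    by (intro borel_measurable_continuous_onI continuous_intros)
  have [measurable]: "(\<lambda>f::L2. (norm f)\<^sup>2) \<in> borel_measurable borel"
    by (intro borel_measurable_continuous_onI continuous_intros)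
  show ?thesis
    unfolding loglik_def by measurable
qed

lemma white_noise_pairing:
  assumes \<phi>: "orthonormal_basis \<phi>" and sm: "summable (\<lambda>k. inner f (\<phi> k) * e k)"
  shows "(\<Sum>k. inner f (\<phi> k) * white_noise_obs \<phi> f0 e n k)
     = inner f f0 + 1 / sqrt (real n) * (\<Sum>k. inner f (\<phi> k) * e k)"
proof -
  have "(\<lambda>k. inner f (\<phi> k) * inner f0 (\<phi> k) + 1 / sqrt (real n) * (inner f (\<phi> k) * e k))
      sums (inner f f0 + 1 / sqrt (real n) * (\<Sum>k. inner f (\<phi> k) * e k))"
    by (intro sums_add sums_mult Parseval[OF \<phi>] summable_sums sm)
  then show ?thesis
    by (simp add: white_noise_obs_def algebra_simps sums_iff)
qed

text \<open>The log-likelihood is quadratic in \<open>f\<close>. In the linear term of the shift,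
  signal and noise combine to \<open>Z\<close>; since the step is \<open>t / q\<close> with
  \<open>q * q = real n * \<alpha>\<close>, the scaled quadratic term no longer depends on
  \<open>n\<close>. The two summability assumptions make the noise series additive along the
  shift.\<close>

lemma loglik_shift:
  fixes \<phi> :: "nat \<Rightarrow> L2" and f f0 \<psi>0 :: L2 and e :: "nat \<Rightarrow> real" and n :: nat and \<alpha> :: real
  defines "Z \<equiv> sqrt (real n * \<alpha>) * (inner \<psi>0 (f - f0) - 1 / sqrt (real n) * (\<Sum>k. inner \<psi>0 (\<phi> k) * e k))"
  assumes \<phi>: "orthonormal_basis \<phi>" and pos: "real n * \<alpha> > 0"
    and sm: "summable (\<lambda>k. inner f (\<phi> k) * e k)" "summable (\<lambda>k. inner \<psi>0 (\<phi> k) * e k)"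
  shows "\<alpha> * loglik \<phi> n (white_noise_obs \<phi> f0 e n) (f - (t / sqrt (real n * \<alpha>)) *\<^sub>R \<psi>0)
     = \<alpha> * loglik \<phi> n (white_noise_obs \<phi> f0 e n) f + t * Z - t\<^sup>2 * (norm \<psi>0)\<^sup>2 / 2"
proof -
  define q where "q = sqrt (real n * \<alpha>)"
  have q: "q > 0" "q * q = real n * \<alpha>" using pos by (auto simp: q_def)
  define s where "s = t / q"
  have s: "s * q = t" using q by (simp add: s_def)
  define Wf where "Wf = (\<Sum>k. inner f (\<phi> k) * e k)"
  define W0 where "W0 = (\<Sum>k. inner \<psi>0 (\<phi> k) * e k)"
  have ft: "(\<lambda>k. inner (f - s *\<^sub>R \<psi>0) (\<phi> k) * e k) sums (Wf - s * W0)"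
    using sums_diff[OF summable_sums[OF sm(1)] sums_mult[OF summable_sums[OF sm(2)], of s]]
    by (simp add: Wf_def W0_def inner_diff_left algebra_simps)
  have norm_ft: "(norm (f - s *\<^sub>R \<psi>0))\<^sup>2 = (norm f)\<^sup>2 - 2 * s * inner \<psi>0 f + s\<^sup>2 * (norm \<psi>0)\<^sup>2"
    unfolding power2_norm_eq_inner
    by (simp add: inner_diff_left inner_diff_right inner_commute[of f \<psi>0] power2_eq_square algebra_simps del: dot_square_norm)
  have "\<alpha> * loglik \<phi> n (white_noise_obs \<phi> f0 e n) (f - s *\<^sub>R \<psi>0) - \<alpha> * loglik \<phi> n (white_noise_obs \<phi> f0 e n) f
      = (real n * \<alpha>) * (s * (inner \<psi>0 (f - f0) - 1 / sqrt (real n) * W0) - s\<^sup>2 * (norm \<psi>0)\<^sup>2 / 2)"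
  proof -
    define c where "c = 1 / sqrt (real n)"
    show ?thesis
      unfolding loglik_def white_noise_pairing[OF \<phi> sm(1)] white_noise_pairing[OF \<phi> sums_summable[OF ft]]
        sums_unique[OF ft, symmetric] norm_ft Wf_def[symmetric] c_def[symmetric]
      unfolding inner_diff_left inner_diff_right inner_scaleR_left
      by (simp add: algebra_simps)
  qed
  also have "\<dots> = t * (q * (inner \<psi>0 (f - f0) - 1 / sqrt (real n) * W0)) - t\<^sup>2 * (norm \<psi>0)\<^sup>2 / 2"
    unfolding q(2)[symmetric] s[symmetric] by (simp add: power2_eq_square algebra_simps)
  finally show ?thesis
    by (simp add: Z_def q_def s_def W0_def)
qed

section \<open>The Laplace transform of the tempered posterior\<close>

text \<open>If the likelihood is not integrable, the normaliser is \<open>0\<close>, division by it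
  gives density zero and the posterior is the zero measure. One set of nonzero measure rules this
  out, and then the total mass is one.\<close>

lemma alpha_posterior_prob_space:
  assumes "prob_space p" and sets: "sets p = sets borel"
    and nz: "measure (alpha_posterior \<phi> n p \<alpha> y) A \<noteq> 0"
  shows "prob_space (alpha_posterior \<phi> n p \<alpha> y)"
proof -
  interpret p: prob_space p by fact
  have [measurable_cong]: "sets p = sets borel" by fact
  define D where "D = (LINT g|p. exp (\<alpha> * loglik \<phi> n y g))"
  have "D \<noteq> 0"
  proof
    assume "D = 0"
    then have "emeasure (alpha_posterior \<phi> n p \<alpha> y) B = 0" for B
      unfolding alpha_posterior_def D_def[symmetric]
      by (cases "B \<in> sets p") (simp_all add: emeasure_density emeasure_notin_sets)
    with nz show False by (simp add: measure_def)
  qed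
  moreover have "D \<ge> 0" unfolding D_def by (intro Bochner_Integration.integral_nonneg) simp
  ultimately have D: "D > 0" by simp
  have int: "integrable p (\<lambda>g. exp (\<alpha> * loglik \<phi> n y g))"
    using \<open>D \<noteq> 0\<close> unfolding D_def by (rule contrapos_np) (rule not_integrable_integral_eq)
  have "(\<integral>\<^sup>+ f. ennreal (exp (\<alpha> * loglik \<phi> n y f) / D) \<partial>p) = ennreal (LINT f|p. exp (\<alpha> * loglik \<phi> n y f) / D)"
    using D int by (intro nn_integral_eq_integral) auto
  also have "\<dots> = 1"
    using D by (simp add: D_def)
  finally show "prob_space (alpha_posterior \<phi> n p \<alpha> y)"
    by (intro prob_spaceI) (simp add: alpha_posterior_def D_def emeasure_density cong: nn_integral_cong_simp)
qed

text \<open>The shift formula stands inside an integral against the prior, so summability for almost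
  every \<open>f\<close> is enough. With normaliser \<open>0\<close> the identity persists, both
  sides being zero.\<close>

lemma posterior_laplace:
  fixes \<phi> :: "nat \<Rightarrow> L2" and f0 \<psi>0 :: L2 and e :: "nat \<Rightarrow> real" and n :: nat and \<alpha> :: real
  defines "y \<equiv> white_noise_obs \<phi> f0 e n"
  defines "Z \<equiv> \<lambda>f. sqrt (real n * \<alpha>) * (inner \<psi>0 (f - f0) - 1 / sqrt (real n) * (\<Sum>k. inner \<psi>0 (\<phi> k) * e k))"
  assumes "prob_space p" and sets: "sets p = sets borel"
    and \<phi>: "orthonormal_basis \<phi>" and pos: "real n * \<alpha> > 0" and A: "A \<in> sets borel"
    and sm: "AE f in p. summable (\<lambda>k. inner f (\<phi> k) * e k)" "summable (\<lambda>k. inner \<psi>0 (\<phi> k) * e k)"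
  shows "(LINT f:A|p. exp (\<alpha> * loglik \<phi> n y (f - (t / sqrt (real n * \<alpha>)) *\<^sub>R \<psi>0)))
       / (LINT f|p. exp (\<alpha> * loglik \<phi> n y f))
     = exp (- (t\<^sup>2 * (norm \<psi>0)\<^sup>2 / 2)) * (LINT f|alpha_posterior \<phi> n p \<alpha> y. indicator A f * exp (t * Z f))"
proof -
  interpret p: prob_space p by fact
  have [measurable_cong]: "sets p = sets borel" by fact
  note A [measurable]
  define D where "D = (LINT g|p. exp (\<alpha> * loglik \<phi> n y g))"
  have D: "D \<ge> 0" unfolding D_def by (intro Bochner_Integration.integral_nonneg) simp
  have Z [measurable]: "Z \<in> borel_measurable borel"
    unfolding Z_def by (intro borel_measurable_continuous_onI continuous_intros)
  have [measurable]: "(\<lambda>f. f - c *\<^sub>R \<psi>0) \<in> borel_measurable borel" for c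
    by (intro borel_measurable_continuous_onI continuous_intros)
  let ?c = "exp (- (t\<^sup>2 * (norm \<psi>0)\<^sup>2 / 2))"
  let ?ft = "\<lambda>f. f - (t / sqrt (real n * \<alpha>)) *\<^sub>R \<psi>0"
  have shift: "AE f in p. exp (\<alpha> * loglik \<phi> n y (?ft f)) = ?c * (exp (\<alpha> * loglik \<phi> n y f) * exp (t * Z f))"
    using sm(1)
  proof eventually_elim
    case (elim f)
    show ?case
      using loglik_shift[OF \<phi> pos elim sm(2), of f0 t]
      by (simp add: y_def Z_def flip: exp_add)
  qed
  have [measurable]: "(\<lambda>f. exp (\<alpha> * loglik \<phi> n y f) / D * (indicator A f * exp (t * Z f))) \<in> borel_measurable p"
    by measurable
  have "(LINT f|alpha_posterior \<phi> n p \<alpha> y. indicator A f * exp (t * Z f))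
      = (LINT f|p. exp (\<alpha> * loglik \<phi> n y f) / D * (indicator A f * exp (t * Z f)))"
    unfolding alpha_posterior_def D_def[symmetric]
    using D by (subst integral_density) auto
  moreover have "(LINT f:A|p. exp (\<alpha> * loglik \<phi> n y (?ft f))) / D
      = (LINT f|p. ?c * (exp (\<alpha> * loglik \<phi> n y f) / D * (indicator A f * exp (t * Z f))))"
  proof -
    have "(LINT f:A|p. exp (\<alpha> * loglik \<phi> n y (?ft f))) / D
        = (LINT f|p. (indicator A f *\<^sub>R exp (\<alpha> * loglik \<phi> n y (?ft f))) / D)"
      by (simp add: set_lebesgue_integral_def)
    also have "\<dots> = (LINT f|p. ?c * (exp (\<alpha> * loglik \<phi> n y f) / D * (indicator A f * exp (t * Z f))))"
    proof (rule integral_cong_AE)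
      show "AE f in p. (indicator A f *\<^sub>R exp (\<alpha> * loglik \<phi> n y (?ft f))) / D
        = ?c * (exp (\<alpha> * loglik \<phi> n y f) / D * (indicator A f * exp (t * Z f)))"
        using shift by eventually_elim (simp add: field_simps)
    qed measurable
    finally show ?thesis .
  qed
  ultimately show ?thesis by (simp add: D_def)
qed

text \<open>Multiplying the error of the ratio by the Gaussian transform gives the first summand of
  the bound. The second is the mass outside \<open>A\<close>, where the variable is \<open>0\<close>
  and its exponential is \<open>1\<close>.\<close>

lemma posterior_laplace_close:
  fixes \<phi> :: "nat \<Rightarrow> L2" and f0 \<psi>0 :: L2 and e :: "nat \<Rightarrow> real" and n :: nat and \<alpha> :: real
  defines "y \<equiv> white_noise_obs \<phi> f0 e n"
  defines "Z \<equiv> \<lambda>f. sqrt (real n * \<alpha>) * (inner \<psi>0 (f - f0) - 1 / sqrt (real n) * (\<Sum>k. inner \<psi>0 (\<phi> k) * e k))"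
  assumes p: "prob_space p" and sets: "sets p = sets borel"
    and \<phi>: "orthonormal_basis \<phi>" and pos: "real n * \<alpha> > 0" and A: "A \<in> sets borel"
    and sm: "AE f in p. summable (\<lambda>k. inner f (\<phi> k) * e k)" "summable (\<lambda>k. inner \<psi>0 (\<phi> k) * e k)"
    and mass: "\<bar>measure (alpha_posterior \<phi> n p \<alpha> y) A - 1\<bar> \<le> \<epsilon>1" "\<epsilon>1 < 1"
    and ratio: "\<bar>(LINT f:A|p. exp (\<alpha> * loglik \<phi> n y (f - (t / sqrt (real n * \<alpha>)) *\<^sub>R \<psi>0)))
       / (LINT f|p. exp (\<alpha> * loglik \<phi> n y f)) - 1\<bar> \<le> \<epsilon>2" "\<epsilon>2 < 1"
  shows "\<bar>(LINT x|distr (alpha_posterior \<phi> n p \<alpha> y) borel (\<lambda>f. indicator A f * Z f). exp (t * x))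
      - exp (t\<^sup>2 * (norm \<psi>0)\<^sup>2 / 2)\<bar> \<le> exp (t\<^sup>2 * (norm \<psi>0)\<^sup>2 / 2) * \<epsilon>2 + \<epsilon>1"
proof -
  let ?post = "alpha_posterior \<phi> n p \<alpha> y"
  let ?E = "exp (t\<^sup>2 * (norm \<psi>0)\<^sup>2 / 2)"
  have "measure ?post A \<noteq> 0" using mass by auto
  from alpha_posterior_prob_space[OF p sets this] interpret post: prob_space ?post by simp
  have sets_post [measurable_cong]: "sets ?post = sets borel"
    by (simp add: alpha_posterior_def sets)
  have Z [measurable]: "Z \<in> borel_measurable borel"
    unfolding Z_def by (intro borel_measurable_continuous_onI continuous_intros)
  note A [measurable]
  define I where "I = (LINT f|?post. indicator A f * exp (t * Z f))"
  have R: "(LINT f:A|p. exp (\<alpha> * loglik \<phi> n y (f - (t / sqrt (real n * \<alpha>)) *\<^sub>R \<psi>0)))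
       / (LINT f|p. exp (\<alpha> * loglik \<phi> n y f)) = I / ?E"
    unfolding I_def y_def Z_def posterior_laplace[OF p sets \<phi> pos A sm] by (simp add: exp_minus field_simps)
  \<comment> \<open>A ratio within less than \<open>1\<close> of \<open>1\<close> is not zero, which
    makes the exponential integrable.\<close>
  have "I \<noteq> 0" using ratio unfolding R by auto
  then have int: "integrable ?post (\<lambda>f. indicator A f * exp (t * Z f))"
    unfolding I_def by (rule contrapos_np) (rule not_integrable_integral_eq)
  have "(LINT x|distr ?post borel (\<lambda>f. indicator A f * Z f). exp (t * x)) = (LINT f|?post. exp (t * (indicator A f * Z f)))"
    by (rule integral_distr) measurable
  also have "\<dots> = (LINT f|?post. indicator A f * exp (t * Z f) + indicator (space ?post - A) f)"
    by (intro Bochner_Integration.integral_cong) (auto simp: indicator_def)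
  also have "\<dots> = I + measure ?post (space ?post - A)"
  proof -
    have compl: "space ?post - A \<in> sets ?post"
      by (intro sets.compl_sets) (simp add: sets_post A)
    then have "integrable ?post (indicator (space ?post - A) :: L2 \<Rightarrow> real)"
      by (intro integrable_real_indicator) (auto simp: less_top[symmetric])
    then show ?thesis
      using int by (simp add: I_def Int_absorb1)
  qed
  also have "measure ?post (space ?post - A) = 1 - measure ?post A"
    using A by (intro post.prob_compl) (simp add: sets_post)
  moreover have "?E * (I / ?E - 1) = I - ?E"
    by (simp add: right_diff_distrib)
  ultimately have eq: "(LINT x|distr ?post borel (\<lambda>f. indicator A f * Z f). exp (t * x)) - ?E
      = ?E * (I / ?E - 1) + (1 - measure ?post A)"
    by simp
  have "\<bar>?E * (I / ?E - 1)\<bar> \<le> ?E * \<epsilon>2"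
    unfolding abs_mult using ratio(1)[unfolded R] by (intro mult_mono) auto
  then show ?thesis
    unfolding eq using mass(1) by linarith
qed

section \<open>Bounds for the bounded Lipschitz distance\<close>

text \<open>Both laws are images of one measure, so the variables are compared pointwise: on
  \<open>A\<close> by the Lipschitz bound, elsewhere by \<open>2\<close>, the largest possible gap
  between values of \<open>h\<close>.\<close>

lemma integral_lipschitz_distr_close:
  fixes h T U :: "_ \<Rightarrow> real"
  assumes "prob_space M" and A [measurable]: "A \<in> sets M"
    and T [measurable]: "T \<in> borel_measurable M" and U [measurable]: "U \<in> borel_measurable M"
    and h: "1-lipschitz_on UNIV h" "\<And>x. \<bar>h x\<bar> \<le> 1"
    and close: "\<And>x. x \<in> A \<Longrightarrow> \<bar>T x - U x\<bar> \<le> \<kappa>" and "\<kappa> \<ge> 0"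
  shows "\<bar>(LINT x|distr M borel T. h x) - (LINT x|distr M borel U. h x)\<bar> \<le> \<kappa> + 2 * (1 - measure M A)"
proof -
  interpret prob_space M by fact
  have hm: "h \<in> borel_measurable borel"
    using h by (intro borel_measurable_continuous_onI lipschitz_on_continuous_on)
  note hT = measurable_compose[OF T hm] and hU = measurable_compose[OF U hm]
  have int: "integrable M (\<lambda>x. h (T x))" "integrable M (\<lambda>x. h (U x))"
    using h hT hU by (intro integrable_const_bound[where B=1]; simp)+
  have "\<bar>h (T x) - h (U x)\<bar> \<le> \<kappa> + 2 * indicator (space M - A) x" if x: "x \<in> space M" for x
  proof (cases "x \<in> A")
    case True
    have "\<bar>h (T x) - h (U x)\<bar> \<le> \<bar>T x - U x\<bar>"
      using lipschitz_onD[OF h(1), of "T x" "U x"] by (simp add: dist_real_def)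
    with close[OF True] True show ?thesis by simp
  next
    case False
    then show ?thesis using h(2)[of "T x"] h(2)[of "U x"] x \<open>\<kappa> \<ge> 0\<close> by simp
  qed
  moreover have ind: "integrable M (indicator (space M - A) :: _ \<Rightarrow> real)"
    by (intro integrable_real_indicator) (auto simp: less_top[symmetric])
  ultimately have "(LINT x|M. \<bar>h (T x) - h (U x)\<bar>) \<le> (LINT x|M. \<kappa> + 2 * indicator (space M - A) x)"
    using int by (intro integral_mono) auto
  also have "\<dots> = \<kappa> + 2 * (1 - measure M A)"
    using ind by (simp add: prob_space prob_compl[OF A, symmetric] Int_absorb1 right_diff_distrib[symmetric] del: integral_indicator)
  finally have "(LINT x|M. \<bar>h (T x) - h (U x)\<bar>) \<le> \<kappa> + 2 * (1 - measure M A)" .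
  moreover have "\<bar>(LINT x|M. h (T x) - h (U x))\<bar> \<le> (LINT x|M. \<bar>h (T x) - h (U x)\<bar>)"
    by (rule integral_abs_bound)
  ultimately show ?thesis
    using int by (simp add: integral_distr[OF T hm] integral_distr[OF U hm])
qed

lemma bounded_lipschitz_dist_leI:
  assumes "\<And>h. 1-lipschitz_on UNIV h \<Longrightarrow> (\<And>x. \<bar>h x\<bar> \<le> 1) \<Longrightarrow> \<bar>(LINT x|\<mu>. h x) - (LINT x|\<nu>. h x)\<bar> \<le> b"
  shows "\<bar>bounded_lipschitz_dist \<mu> \<nu>\<bar> \<le> ereal b"
proof -
  have "bounded_lipschitz_dist \<mu> \<nu> \<le> ereal b"
    unfolding bounded_lipschitz_dist_def by (rule SUP_least) (use assms in auto)
  moreover have "0 \<le> bounded_lipschitz_dist \<mu> \<nu>"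
    unfolding bounded_lipschitz_dist_def
    by (rule SUP_upper2[where i="\<lambda>_. 0"]) (auto simp: lipschitz_on_def)
  ultimately show ?thesis by simp
qed

lemma small_o_PD:
  "small_o_P M X \<Longrightarrow> \<eta> > 0 \<Longrightarrow> (\<lambda>n. outer_measure_of M {\<omega> \<in> space M. \<bar>X n \<omega>\<bar> > ereal \<eta>}) \<longlonglongrightarrow> 0"
  by (simp add: small_o_P_def)

theorem theorem2p3:
  fixes P :: "'w measure" and \<epsilon> :: "nat \<Rightarrow> 'w \<Rightarrow> real"
    and \<phi> :: "nat \<Rightarrow> L2" and f0 \<psi>0 :: L2
    and prior :: "nat \<Rightarrow> L2 measure" and \<alpha> :: "nat \<Rightarrow> real"
    and \<psi> :: "L2 \<Rightarrow> real" and r :: "L2 \<Rightarrow> L2 \<Rightarrow> real"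
    and A :: "nat \<Rightarrow> L2 set"
    and Y :: "nat \<Rightarrow> 'w \<Rightarrow> nat \<Rightarrow> real" and \<psi>hat :: "nat \<Rightarrow> 'w \<Rightarrow> real"
  assumes "prob_space P" and "iid_std_normal P \<epsilon>"
    and "orthonormal_basis \<phi>"
    and Y_def: "\<And>n \<omega>. Y n \<omega> = white_noise_obs \<phi> f0 (\<lambda>k. \<epsilon> k \<omega>) n"
    and "\<And>n. n \<ge> 1 \<Longrightarrow> prob_space (prior n) \<and> sets (prior n) = sets borel"
    and "\<And>n. n \<ge> 1 \<Longrightarrow> 0 < \<alpha> n \<and> \<alpha> n \<le> 1"
    and "filterlim (\<lambda>n. real n * \<alpha> n) at_top sequentially"
    and "\<psi> \<in> borel_measurable borel"
    and expansion: "\<And>f. \<psi> f - \<psi> f0 = inner \<psi>0 (f - f0) + r f f0"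
    and "\<And>n. n \<ge> 1 \<Longrightarrow> A n \<in> sets borel"
    and "small_o_P P (\<lambda>n \<omega>. ereal (measure (alpha_posterior \<phi> n (prior n) (\<alpha> n) (Y n \<omega>)) (A n) - 1))"
    and "\<And>t::real. small_o_P P (\<lambda>n \<omega>. SUP f\<in>A n. ereal \<bar>t * sqrt (real n * \<alpha> n) * r f f0\<bar>)"
    and "\<And>t::real. small_o_P P (\<lambda>n \<omega>. ereal (
           (LINT f:A n|prior n. exp (\<alpha> n * loglik \<phi> n (Y n \<omega>) (f - (t / sqrt (real n * \<alpha> n)) *\<^sub>R \<psi>0)))
           / (LINT f|prior n. exp (\<alpha> n * loglik \<phi> n (Y n \<omega>) f)) - 1))"
    and \<psi>hat_def: "\<And>n \<omega>. \<psi>hat n \<omega> = \<psi> f0 + 1 / sqrt (real n) * (\<Sum>k. inner \<psi>0 (\<phi> k) * \<epsilon> k \<omega>)"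
  shows "weakly_in_prob P
           (\<lambda>n \<omega>. distr (alpha_posterior \<phi> n (prior n) (\<alpha> n) (Y n \<omega>)) borel
                     (\<lambda>f. sqrt (real n * \<alpha> n) * (\<psi> f - \<psi>hat n \<omega>)))
           (gaussian 0 ((norm \<psi>0)\<^sup>2))"
proof -
  note iid = assms(2) and \<phi> = assms(3) and prior = assms(5) and \<alpha> = assms(6) and \<psi> = assms(8)
    and A = assms(10) and mass_o = assms(11) and rem_o = assms(12) and ratio_o = assms(13)
  interpret P: prob_space P by fact
  define V where "V = (norm \<psi>0)\<^sup>2"
  have V: "V \<ge> 0" by (simp add: V_def)
  define post where "post n \<omega> = alpha_posterior \<phi> n (prior n) (\<alpha> n) (Y n \<omega>)" for n \<omega>
  define ratio where "ratio t n \<omega> = (LINT f:A n|prior n. exp (\<alpha> n * loglik \<phi> n (Y n \<omega>) (f - (t / sqrt (real n * \<alpha> n)) *\<^sub>R \<psi>0)))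
           / (LINT f|prior n. exp (\<alpha> n * loglik \<phi> n (Y n \<omega>) f))" for t n \<omega>
  \<comment> \<open>The remainder hypothesis is used at \<open>t = 1\<close>; the visible factor
    \<open>1\<close> makes this literally that instance.\<close>
  define rem where "rem n = (SUP f\<in>A n. ereal \<bar>1 * sqrt (real n * \<alpha> n) * r f f0\<bar>)" for n
  define T where "T n \<omega> f = sqrt (real n * \<alpha> n) * (\<psi> f - \<psi>hat n \<omega>)" for n \<omega> f
  \<comment> \<open>For such noise the series in the shift formula are true sums for almost every
    \<open>f\<close>. The remaining noise forms a null event and can be joined to the other
    exceptional events.\<close>
  define good where "good n \<omega> \<longleftrightarrow> (AE f in prior n. summable (\<lambda>k. inner f (\<phi> k) * \<epsilon> k \<omega>)) \<and>
    summable (\<lambda>k. inner \<psi>0 (\<phi> k) * \<epsilon> k \<omega>)" for n \<omega>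
  have good: "outer_measure_of P {\<omega> \<in> space P. \<not> good n \<omega>} = 0" if "n \<ge> 1" for n
  proof -
    have "AE \<omega> in P. good n \<omega>"
      unfolding good_def
      using AE_prior_summable[OF P.prob_space_axioms iid \<phi>, of "prior n"] prior[OF that]
        P.AE_summable_gaussian_series[OF iid summable_square_coeffs[OF \<phi>], of \<psi>0] by auto
    then obtain N where N: "{\<omega> \<in> space P. \<not> good n \<omega>} \<subseteq> N" "emeasure P N = 0" "N \<in> sets P"
      by (rule AE_E)
    then have "outer_measure_of P {\<omega> \<in> space P. \<not> good n \<omega>} \<le> 0"
      using outer_measure_of_mono[OF N(1), of P] by simp
    then show ?thesis by simp
  qed
  show ?thesis
    unfolding weakly_in_prob_def small_o_P_def post_def[symmetric] T_def[symmetric] V_def[symmetric]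
  proof (intro allI impI)
    fix \<eta> :: real assume \<eta>: "\<eta> > 0"
    have "\<eta> / 4 > 0" using \<eta> by simp
    from mgf_close_imp_lipschitz_close[where N="gaussian 0 V" and \<eta>="\<eta> / 4",
        OF gaussian_real_distribution[OF V] gaussian_exp(1)[OF V] this, unfolded gaussian_exp(2)[OF V]]
    obtain S \<delta> where S_\<delta>: "finite S \<and> \<delta> > 0 \<and> (\<forall>\<mu> (h :: real \<Rightarrow> real). real_distribution \<mu> \<longrightarrow>
       (\<forall>t\<in>S. \<bar>(LINT x|\<mu>. exp (t * x)) - exp (t\<^sup>2 * V / 2)\<bar> < \<delta>) \<longrightarrow> 1-lipschitz_on UNIV h \<longrightarrow>
       (\<forall>x. \<bar>h x\<bar> \<le> 1) \<longrightarrow> \<bar>(LINT x|\<mu>. h x) - (LINT x|gaussian 0 V. h x)\<bar> < \<eta> / 4)"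
      by (elim exE) (rule that)
    then have S: "finite S" and \<delta>: "\<delta> > 0" by auto
    have close: "\<bar>(LINT x|\<mu>. h x) - (LINT x|gaussian 0 V. h x)\<bar> < \<eta> / 4"
      if "real_distribution \<mu>" "\<And>t. t \<in> S \<Longrightarrow> \<bar>(LINT x|\<mu>. exp (t * x)) - exp (t\<^sup>2 * V / 2)\<bar> < \<delta>"
        "1-lipschitz_on UNIV h" "\<And>x. \<bar>h x\<bar> \<le> 1" for \<mu> and h :: "real \<Rightarrow> real"
      using S_\<delta> that by blast
    \<comment> \<open>Error budget: two shares of at most \<open>\<delta> / 4\<close> keep each
      transform within \<open>\<delta>\<close>, the exponential in \<open>\<epsilon>2\<close>
      cancels the one in \<open>posterior_laplace_close\<close>, and \<open>\<eta> / 16\<close>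
      limits the effect of the mass outside \<open>A n\<close> to \<open>\<eta> / 8\<close>. The
      caps \<open>1 / 2\<close> keep mass and ratio away from zero.\<close>
    define \<epsilon>1 where "\<epsilon>1 = min (1 / 2) (min (\<delta> / 4) (\<eta> / 16))"
    define \<epsilon>2 where "\<epsilon>2 t = min (1 / 2) (\<delta> / (4 * exp (t\<^sup>2 * V / 2)))" for t
    have \<epsilon>1: "\<epsilon>1 > 0" "\<epsilon>1 < 1" "\<epsilon>1 \<le> \<delta> / 4" "\<epsilon>1 \<le> \<eta> / 16" using \<delta> \<eta> by (auto simp: \<epsilon>1_def)
    have \<epsilon>2: "\<epsilon>2 t > 0" "\<epsilon>2 t < 1" "exp (t\<^sup>2 * V / 2) * \<epsilon>2 t \<le> \<delta> / 4" for t
    proof -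
      show "\<epsilon>2 t > 0" "\<epsilon>2 t < 1" using \<delta> by (auto simp: \<epsilon>2_def)
      have "exp (t\<^sup>2 * V / 2) * \<epsilon>2 t \<le> exp (t\<^sup>2 * V / 2) * (\<delta> / (4 * exp (t\<^sup>2 * V / 2)))"
        by (intro mult_left_mono) (auto simp: \<epsilon>2_def)
      then show "exp (t\<^sup>2 * V / 2) * \<epsilon>2 t \<le> \<delta> / 4" by simp
    qed
    have key: "\<bar>bounded_lipschitz_dist (distr (post n \<omega>) borel (T n \<omega>)) (gaussian 0 V)\<bar> \<le> ereal \<eta>"
      if n: "n \<ge> 1" and g: "good n \<omega>" and mass: "\<bar>measure (post n \<omega>) (A n) - 1\<bar> \<le> \<epsilon>1"
        and rem: "\<bar>rem n\<bar> \<le> ereal (\<eta> / 4)" and ratio: "\<And>t. t \<in> S \<Longrightarrow> \<bar>ratio t n \<omega> - 1\<bar> \<le> \<epsilon>2 t" for n \<omega>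
    proof (rule bounded_lipschitz_dist_leI)
      fix h :: "real \<Rightarrow> real" assume h: "1-lipschitz_on UNIV h" "\<And>x. \<bar>h x\<bar> \<le> 1"
      have pr: "prob_space (prior n)" "sets (prior n) = sets borel" using prior[OF n] by auto
      have pos: "real n * \<alpha> n > 0" using \<alpha>[OF n] n by simp
      have post_eq: "post n \<omega> = alpha_posterior \<phi> n (prior n) (\<alpha> n) (white_noise_obs \<phi> f0 (\<lambda>k. \<epsilon> k \<omega>) n)"
        by (simp add: post_def Y_def)
      have "measure (post n \<omega>) (A n) \<noteq> 0" using mass \<epsilon>1 by auto
      then have ps: "prob_space (post n \<omega>)"
        unfolding post_def by (rule alpha_posterior_prob_space[OF pr])
      have sets_post: "sets (post n \<omega>) = sets borel" by (simp add: post_def alpha_posterior_def pr)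
      define Z where "Z f = sqrt (real n * \<alpha> n) * (inner \<psi>0 (f - f0) - 1 / sqrt (real n) * (\<Sum>k. inner \<psi>0 (\<phi> k) * \<epsilon> k \<omega>))" for f
      have Z_meas: "Z \<in> borel_measurable borel"
        unfolding Z_def by (intro borel_measurable_continuous_onI continuous_intros)
      define U where "U f = indicator (A n) f * Z f" for f
      have U_meas: "U \<in> borel_measurable (post n \<omega>)"
        unfolding U_def measurable_cong_sets[OF sets_post refl]
        using A[OF n] Z_meas by measurable
      have T_meas: "T n \<omega> \<in> borel_measurable (post n \<omega>)"
        unfolding T_def measurable_cong_sets[OF sets_post refl] using \<psi> by measurable
      have "\<bar>(LINT x|distr (post n \<omega>) borel (T n \<omega>). h x) - (LINT x|distr (post n \<omega>) borel U. h x)\<bar>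
          \<le> \<eta> / 4 + 2 * (1 - measure (post n \<omega>) (A n))"
      proof (rule integral_lipschitz_distr_close[OF ps _ T_meas U_meas h])
        show "A n \<in> sets (post n \<omega>)" using A[OF n] by (simp add: sets_post)
        fix f assume f: "f \<in> A n"
        \<comment> \<open>The centring \<open>\<psi>hat\<close> contains the same noise term as
          \<open>Z\<close>, so on \<open>A n\<close> only the remainder survives.\<close>
        have "T n \<omega> f - U f = sqrt (real n * \<alpha> n) * r f f0"
        proof -
          have psi: "\<psi> f = \<psi> f0 + inner \<psi>0 (f - f0) + r f f0"
            using expansion[of f] by simp
          show ?thesis
            using f unfolding T_def U_def Z_def \<psi>hat_def psi by (simp add: algebra_simps)
        qed
        moreover have "ereal \<bar>1 * sqrt (real n * \<alpha> n) * r f f0\<bar> \<le> ereal (\<eta> / 4)"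
        proof -
          have "ereal \<bar>1 * sqrt (real n * \<alpha> n) * r f f0\<bar> \<le> rem n"
            unfolding rem_def using f by (rule SUP_upper)
          also have "\<dots> \<le> \<bar>rem n\<bar>" by (cases "rem n") auto
          finally show ?thesis using rem by (rule order_trans)
        qed
        ultimately show "\<bar>T n \<omega> f - U f\<bar> \<le> \<eta> / 4" by simp
      qed (use \<eta> in simp)
      moreover have "\<bar>(LINT x|distr (post n \<omega>) borel U. h x) - (LINT x|gaussian 0 V. h x)\<bar> < \<eta> / 4"
      proof (rule close[OF _ _ h])
        show "real_distribution (distr (post n \<omega>) borel U)"
          by (intro real_distribution.intro real_distribution_axioms.intro prob_space.prob_space_distr[OF ps U_meas]) simp_all
        fix t assume t: "t \<in> S"
        have "\<bar>(LINT x|distr (post n \<omega>) borel U. exp (t * x)) - exp (t\<^sup>2 * V / 2)\<bar> \<le> exp (t\<^sup>2 * V / 2) * \<epsilon>2 t + \<epsilon>1"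
          unfolding post_eq U_def[abs_def] V_def Z_def
          using g mass ratio[OF t] \<epsilon>1 \<epsilon>2[of t]
          by (intro posterior_laplace_close[OF pr \<phi> pos A[OF n]])
             (auto simp: good_def post_eq ratio_def Y_def)
        also have "\<dots> < \<delta>" using \<epsilon>1 \<epsilon>2(3)[of t] \<delta> by linarith
        finally show "\<bar>(LINT x|distr (post n \<omega>) borel U. exp (t * x)) - exp (t\<^sup>2 * V / 2)\<bar> < \<delta>" .
      qed
      ultimately show "\<bar>(LINT x|distr (post n \<omega>) borel (T n \<omega>). h x) - (LINT x|gaussian 0 V. h x)\<bar> \<le> \<eta>"
      proof -
        assume 1: "\<bar>(LINT x|distr (post n \<omega>) borel (T n \<omega>). h x) - (LINT x|distr (post n \<omega>) borel U. h x)\<bar>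
            \<le> \<eta> / 4 + 2 * (1 - measure (post n \<omega>) (A n))"
          and 2: "\<bar>(LINT x|distr (post n \<omega>) borel U. h x) - (LINT x|gaussian 0 V. h x)\<bar> < \<eta> / 4"
        have "1 - measure (post n \<omega>) (A n) \<le> \<epsilon>1" using mass by (simp add: abs_le_iff)
        then have "\<eta> / 4 + 2 * (1 - measure (post n \<omega>) (A n)) \<le> \<eta> / 2" using \<epsilon>1(4) \<eta> by simp
        then have 3: "\<eta> / 4 + 2 * (1 - measure (post n \<omega>) (A n)) + \<eta> / 4 \<le> \<eta>" using \<eta> by simp
        have "\<bar>a - c\<bar> \<le> q" if "\<bar>a - b\<bar> \<le> s" "\<bar>b - c\<bar> < u" "s + u \<le> q" for a b c s u q :: real
          using that by linarith
        from this[OF 1 2 3] show ?thesis .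
      qed
    qed
    \<comment> \<open>Nothing is assumed of the prior at \<open>n = 0\<close>; the guard makes the
      event empty there.\<close>
    define E0 where "E0 n = {\<omega> \<in> space P. n \<ge> 1 \<and> \<not> good n \<omega>}" for n
    define E1 where "E1 n = {\<omega> \<in> space P. \<bar>ereal (measure (post n \<omega>) (A n) - 1)\<bar> > ereal \<epsilon>1}" for n
    define E2 where "E2 n = {\<omega> \<in> space P. \<bar>rem n\<bar> > ereal (\<eta> / 4)}" for n
    define E3 where "E3 t n = {\<omega> \<in> space P. \<bar>ereal (ratio t n \<omega> - 1)\<bar> > ereal (\<epsilon>2 t)}" for t n
    have "outer_measure_of P (E0 n) = 0" for n
      using good[of n] by (cases "n \<ge> 1") (auto simp: E0_def)
    then have lim0: "(\<lambda>n. outer_measure_of P (E0 n)) \<longlonglongrightarrow> 0" by simp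
    have lim1: "(\<lambda>n. outer_measure_of P (E1 n)) \<longlonglongrightarrow> 0"
      unfolding E1_def post_def by (rule small_o_PD[OF mass_o \<epsilon>1(1)])
    have lim2: "(\<lambda>n. outer_measure_of P (E2 n)) \<longlonglongrightarrow> 0"
      unfolding E2_def rem_def by (rule small_o_PD[OF rem_o[of 1]]) (use \<eta> in simp)
    have sub: "E0 n \<subseteq> space P" "E1 n \<subseteq> space P" "E2 n \<subseteq> space P" "(\<Union>t\<in>S. E3 t n) \<subseteq> space P" for n
      by (auto simp: E0_def E1_def E2_def E3_def)
    have lim3: "(\<lambda>n. outer_measure_of P (\<Union>t\<in>S. E3 t n)) \<longlonglongrightarrow> 0"
    proof (rule tendsto_outer_measure_UN[OF S])
      fix t show "(\<lambda>n. outer_measure_of P (E3 t n)) \<longlonglongrightarrow> 0"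
        unfolding E3_def ratio_def by (rule small_o_PD[OF ratio_o \<epsilon>2(1)])
    qed (auto simp: E3_def)
    have lim: "(\<lambda>n. outer_measure_of P (E0 n \<union> (E1 n \<union> (E2 n \<union> (\<Union>t\<in>S. E3 t n))))) \<longlonglongrightarrow> 0"
      by (rule tendsto_outer_measure_Un[OF _ _ lim0 tendsto_outer_measure_Un[OF _ _ lim1 tendsto_outer_measure_Un[OF _ _ lim2 lim3]]])
         (use sub in \<open>simp_all\<close>)
    show "(\<lambda>n. outer_measure_of P {\<omega> \<in> space P. \<bar>bounded_lipschitz_dist (distr (post n \<omega>) borel (T n \<omega>)) (gaussian 0 V)\<bar> > ereal \<eta>}) \<longlonglongrightarrow> 0"
    proof (rule tendsto_sandwich[OF _ _ tendsto_const lim])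
      show "eventually (\<lambda>n. outer_measure_of P {\<omega> \<in> space P. \<bar>bounded_lipschitz_dist (distr (post n \<omega>) borel (T n \<omega>)) (gaussian 0 V)\<bar> > ereal \<eta>}
        \<le> outer_measure_of P (E0 n \<union> (E1 n \<union> (E2 n \<union> (\<Union>t\<in>S. E3 t n))))) sequentially"
        using eventually_ge_at_top[of 1]
      proof eventually_elim
        case (elim n)
        show ?case
        proof (rule outer_measure_of_mono, rule subsetI, rule ccontr)
          fix \<omega> assume far: "\<omega> \<in> {\<omega> \<in> space P. \<bar>bounded_lipschitz_dist (distr (post n \<omega>) borel (T n \<omega>)) (gaussian 0 V)\<bar> > ereal \<eta>}"
            and out: "\<omega> \<notin> E0 n \<union> (E1 n \<union> (E2 n \<union> (\<Union>t\<in>S. E3 t n)))"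
          have "\<bar>bounded_lipschitz_dist (distr (post n \<omega>) borel (T n \<omega>)) (gaussian 0 V)\<bar> \<le> ereal \<eta>"
            using far out elim by (intro key) (auto simp: E0_def E1_def E2_def E3_def not_less)
          with far show False by (auto dest: leD)
        qed
      qed
    qed simp
  qed
qed

end
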